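(* For $\star\in\{\mathrm{MM},\mathrm{PM},\mathrm M\}$ and all $d,r$, the group $P_\star(d,r)$ is a free abelian group with basis $\{[R_\star(\underline X,\underline r)]:(\underline X,\underline r)\in\mathfrak p_\star(d,r)\}$.
   Context: $[d]=\{1,\dots,d\}$. A megamatroid on $[d]$ is $\mathrm{rk}:2^{[d]}\to\mathbb Z\cup\{\infty\}$ with $\mathrm{rk}(\emptyset)=0$, $\mathrm{rk}([d])\in\mathbb Z$, and such that whenever $\mathrm{rk}(A),\mathrm{rk}(B)\in\mathbb Z$ we have $\mathrm{rk}(A\cup B),\mathrm{rk}(A\cap B)\in\mathbb Z$ and $\mathrm{rk}(A\cup B)+\mathrm{rk}(A\cap B)\le\mathrm{rk}(A)+\mathrm{rk}(B)$. A polymatroid is a megamatroid with values in $\{0,1,2,\dots\}$ that is monotone ($A\subseteq B\Rightarrow\mathrm{rk}(A)\le\mathrm{rk}(B)$); a matroid is a polymatroid with $\mathrm{rk}(\{i\})\le1$. Rank $=\mathrm{rk}([d])$. Base polyhedron $Q(\mathrm{rk})=\{y\in\mathbb R^d:\sum_iy_i=\mathrm{rk}([d]),\ \sum_{i\in A}y_i\le\mathrm{rk}(A)\ \forall A\}$. $P_{\mathrm{MM}}(d,r)$, $P_{\mathrm{PM}}(d,r)$, $P_{\mathrm M}(d,r)$ are the $\mathbb Z$-modules of functions $\mathbb R^d\to\mathbb Z$ generated by indicator functions $[Q(\mathrm{rk})]$ for megamatroids, polymatroids, matroids on $[d]$ of rank $r$. Let $\Delta_{\mathrm{PM}}(d,r)=\{y\in\mathbb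 R^d:y_i\ge0,\sum y_i=r\}$, $\Delta_{\mathrm M}(d,r)=\{y:0\le y_i\le1,\sum y_i=r\}$. A chain of length $k$ is $\underline X:\emptyset\subset X_1\subset\dots\subset X_k=[d]$ (strict inclusions); conventions $X_0=\emptyset$, $r_0=0$. For an integer vector $\underline r=(r_1,\dots,r_k)$ put $R_{\mathrm{MM}}(\underline X,\underline r)=\{y\in\mathbb R^d:\sum_iy_i=r_k,\ \sum_{i\in X_j}y_i\le r_j\ \forall j\}$, $R_{\mathrm{PM}}(\underline X,\underline r)=R_{\mathrm{MM}}(\underline X,\underline r)\cap\Delta_{\mathrm{PM}}(d,r)$, $R_{\mathrm M}(\underline X,\underline r)=R_{\mathrm{MM}}(\underline X,\underline r)\cap\Delta_{\mathrm M}(d,r)$. For $d\ge1$: $\mathfrak p_{\mathrm{MM}}(d,r)$ is the set of pairs $(\underline X,\underline r)$ with $\underline X$ a chain of length $k$ ($1\le k\le d$) and $\underline r\in\mathbb Z^k$ with $r_k=r$; $\mathfrak p_{\mathrm{PM}}(d,r)$ is the subset with $0\le r_1<r_2<\dots<r_k=r$; $\mathfrak p_{\mathrm M}(d,r)$ is the subset with $0\le r_1<\dots<r_k=r$ and $0<|X_1|-r_1<|X_2|-r_2<\dots<|X_{k-1}|-r_{k-1}\le|X_k|-r_k=d-r$. For $d=0$: all three sets are empty if $r\ne0$, and for $r=0$ each consists of the single pair (the unique chain $\emptyset=[0]$, the empty vector). *)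

theory Defs
  imports Complex_Main "HOL-Library.FuncSet" "HOL-Library.Indicator_Function"
    "HOL-Library.Extended_Real" "HOL-Library.Function_Algebras"
begin

text \<open>The ground set is \<open>[d] = {1..d}\<close>. A point of \<open>\<real>\<^sup>d\<close> is a function on the naturals that is
  \<^term>\<open>undefined\<close> outside \<open>{1..d}\<close>, which allows \<open>d\<close> to be any natural number, including \<open>0\<close>
  (\<open>\<real>\<^sup>0\<close> is a single point). A function \<open>\<real>\<^sup>d \<rightarrow> \<int>\<close> is represented by its extension by zero to
  \<^typ>\<open>nat \<Rightarrow> real\<close>; indicator functions of subsets of \<open>rvec d\<close> are of this form.\<close>

definition rvec :: "nat \<Rightarrow> (nat \<Rightarrow> real) set" where
  "rvec d = ({1..d} \<rightarrow>\<^sub>E UNIV)"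


subsection \<open>Megamatroids, polymatroids and matroids\<close>

definition eInts :: "ereal set" where
  "eInts = range (\<lambda>n::int. ereal (of_int n))"

text \<open>Only the values of \<open>rk\<close> on subsets of \<open>{1..d}\<close> are relevant.\<close>

definition megamatroid :: "nat \<Rightarrow> (nat set \<Rightarrow> ereal) \<Rightarrow> bool" where
  "megamatroid d rk \<longleftrightarrow>
     (\<forall>A\<subseteq>{1..d}. rk A \<in> eInts \<union> {\<infinity>}) \<and>
     rk {} = 0 \<and>
     rk {1..d} \<in> eInts \<and>
     (\<forall>A\<subseteq>{1..d}. \<forall>B\<subseteq>{1..d}. rk A \<in> eInts \<and> rk B \<in> eInts \<longrightarrow>
        rk (A \<union> B) \<in> eInts \<and> rk (A \<inter> B) \<in> eInts \<and>
        rk (A \<union> B) + rk (A \<inter> B) \<le> rk A + rk B)"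

definition polymatroid :: "nat \<Rightarrow> (nat set \<Rightarrow> ereal) \<Rightarrow> bool" where
  "polymatroid d rk \<longleftrightarrow>
     megamatroid d rk \<and>
     (\<forall>A\<subseteq>{1..d}. rk A \<in> range (\<lambda>n::nat. ereal (of_nat n))) \<and>
     (\<forall>A B. A \<subseteq> B \<and> B \<subseteq> {1..d} \<longrightarrow> rk A \<le> rk B)"

definition matroid :: "nat \<Rightarrow> (nat set \<Rightarrow> ereal) \<Rightarrow> bool" where
  "matroid d rk \<longleftrightarrow> polymatroid d rk \<and> (\<forall>i\<in>{1..d}. rk {i} \<le> 1)"

definition base_polyhedron :: "nat \<Rightarrow> (nat set \<Rightarrow> ereal) \<Rightarrow> (nat \<Rightarrow> real) set" where
  "base_polyhedron d rk =
     {y \<in> rvec d. ereal (\<Sum>i\<in>{1..d}. y i) = rk {1..d} \<and>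
                  (\<forall>A\<subseteq>{1..d}. ereal (\<Sum>i\<in>A. y i) \<le> rk A)}"

datatype kind = MM | PM | Mat

fun of_kind :: "kind \<Rightarrow> nat \<Rightarrow> (nat set \<Rightarrow> ereal) \<Rightarrow> bool" where
  "of_kind MM = megamatroid"
| "of_kind PM = polymatroid"
| "of_kind Mat = matroid"


subsection \<open>The \<open>\<int>\<close>-modules generated by indicator functions\<close>

definition zscale :: "int \<Rightarrow> ('a \<Rightarrow> int) \<Rightarrow> 'a \<Rightarrow> int" where
  "zscale c f = (\<lambda>x. c * f x)"

global_interpretation zmod: module zscale
  by standard (auto simp: zscale_def algebra_simps fun_eq_iff)

definition P_group :: "kind \<Rightarrow> nat \<Rightarrow> int \<Rightarrow> ((nat \<Rightarrow> real) \<Rightarrow> int) set" where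
  "P_group \<kappa> d r =
     zmod.span {indicator (base_polyhedron d rk) | rk.
                  of_kind \<kappa> d rk \<and> rk {1..d} = ereal (of_int r)}"

text \<open>The subgroup \<open>P\<close> is free abelian with the family \<open>(b i)\<^sub>i\<^sub>\<in>\<^sub>I\<close> as a basis; being a basis
  as a family, and not just as a set, includes that the \<open>b i\<close> are pairwise distinct.\<close>

definition free_abelian_basis :: "('a \<Rightarrow> int) set \<Rightarrow> 'i set \<Rightarrow> ('i \<Rightarrow> 'a \<Rightarrow> int) \<Rightarrow> bool" where
  "free_abelian_basis P I b \<longleftrightarrow>
     inj_on b I \<and> zmod.independent (b ` I) \<and> zmod.span (b ` I) = P"


subsection \<open>Chains and the polyhedra attached to them\<close>

text \<open>A chain \<open>X\<^sub>1 \<subset> \<dots> \<subset> X\<^sub>k\<close> and a vector \<open>(r\<^sub>1, \<dots>, r\<^sub>k)\<close> are lists; \<open>Xset Xs j\<close> and \<open>rval rs j\<close>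
  are \<open>X\<^sub>j\<close> and \<open>r\<^sub>j\<close> for \<open>0 \<le> j \<le> k\<close>, with the conventions \<open>X\<^sub>0 = \<emptyset>\<close> and \<open>r\<^sub>0 = 0\<close>.\<close>

definition Xset :: "nat set list \<Rightarrow> nat \<Rightarrow> nat set" where
  "Xset Xs j = ({} # Xs) ! j"

definition rval :: "int list \<Rightarrow> nat \<Rightarrow> int" where
  "rval rs j = (0 # rs) ! j"

text \<open>The conditions force \<open>1 \<le> k \<le> d\<close> if \<open>d \<ge> 1\<close>, and \<open>k = 0\<close> if \<open>d = 0\<close>.\<close>

definition is_chain :: "nat \<Rightarrow> nat set list \<Rightarrow> bool" where
  "is_chain d Xs \<longleftrightarrow>
     (\<forall>j<length Xs. Xset Xs j \<subset> Xset Xs (Suc j)) \<and> Xset Xs (length Xs) = {1..d}"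

definition simplex_PM :: "nat \<Rightarrow> int \<Rightarrow> (nat \<Rightarrow> real) set" where
  "simplex_PM d r = {y \<in> rvec d. (\<forall>i\<in>{1..d}. 0 \<le> y i) \<and> (\<Sum>i\<in>{1..d}. y i) = of_int r}"

definition simplex_M :: "nat \<Rightarrow> int \<Rightarrow> (nat \<Rightarrow> real) set" where
  "simplex_M d r =
     {y \<in> rvec d. (\<forall>i\<in>{1..d}. 0 \<le> y i \<and> y i \<le> 1) \<and> (\<Sum>i\<in>{1..d}. y i) = of_int r}"

definition R_MM :: "nat \<Rightarrow> nat set list \<Rightarrow> int list \<Rightarrow> (nat \<Rightarrow> real) set" where
  "R_MM d Xs rs =
     {y \<in> rvec d. (\<Sum>i\<in>{1..d}. y i) = of_int (rval rs (length rs)) \<and>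
                  (\<forall>j\<in>{1..length Xs}. (\<Sum>i\<in>Xset Xs j. y i) \<le> of_int (rval rs j))}"

fun R_poly :: "kind \<Rightarrow> nat \<Rightarrow> nat set list \<times> int list \<Rightarrow> (nat \<Rightarrow> real) set" where
  "R_poly MM d (Xs, rs) = R_MM d Xs rs"
| "R_poly PM d (Xs, rs) = R_MM d Xs rs \<inter> simplex_PM d (rval rs (length rs))"
| "R_poly Mat d (Xs, rs) = R_MM d Xs rs \<inter> simplex_M d (rval rs (length rs))"

definition p_MM :: "nat \<Rightarrow> int \<Rightarrow> (nat set list \<times> int list) set" where
  "p_MM d r =
     {(Xs, rs). is_chain d Xs \<and> length rs = length Xs \<and> rval rs (length rs) = r}"

definition p_PM :: "nat \<Rightarrow> int \<Rightarrow> (nat set list \<times> int list) set" where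
  "p_PM d r =
     {(Xs, rs) \<in> p_MM d r.
        (1 \<le> length rs \<longrightarrow> 0 \<le> rval rs 1) \<and>
        (\<forall>j. 1 \<le> j \<and> j < length rs \<longrightarrow> rval rs j < rval rs (Suc j))}"

text \<open>The inequalities \<open>0 < |X\<^sub>1| - r\<^sub>1 < \<dots> < |X\<^sub>k\<^sub>-\<^sub>1| - r\<^sub>k\<^sub>-\<^sub>1 \<le> |X\<^sub>k| - r\<^sub>k\<close> start at
  \<open>|X\<^sub>0| - r\<^sub>0 = 0\<close>, and only the last one is weak. In particular they read \<open>0 \<le> d - r\<close> for
  \<open>k = 1\<close>; so for \<open>r = d\<close> the one-term chain is included.\<close>

definition p_M :: "nat \<Rightarrow> int \<Rightarrow> (nat set list \<times> int list) set" where
  "p_M d r =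
     {(Xs, rs) \<in> p_PM d r.
        (let k = length Xs; c = (\<lambda>j. int (card (Xset Xs j)) - rval rs j) in
           (\<forall>j. 1 \<le> j \<and> j < k \<longrightarrow> c (j - 1) < c j) \<and>
           (1 \<le> k \<longrightarrow> c (k - 1) \<le> c k))}"

fun p_set :: "kind \<Rightarrow> nat \<Rightarrow> int \<Rightarrow> (nat set list \<times> int list) set" where
  "p_set MM = p_MM"
| "p_set PM = p_PM"
| "p_set Mat = p_M"

end

theory Submission
  imports Defs "HOL-Analysis.Function_Metric" "HOL-Analysis.Convex_Euclidean_Space"
begin

text \<open>Independence. After intersecting with a box \<open>[l, u]\<^sup>d\<close> (\<open>l = 0\<close>, \<open>u = 1\<close> for matroids, \<open>l = 0\<close> and
  \<open>u\<close> large for polymatroids, \<open>l = - u\<close> and \<open>u\<close> large for megamatroids), every \<open>R(X, r)\<close> becomes the base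
  polytope of the integral submodular function
  \<open>f(A) = min\<^sub>j (r\<^sub>j + u |A - X\<^sub>j| - l |X\<^sub>j - A|)\<close>. The Euler characteristic is additive on compact convex
  sets, so a relation between indicator functions gives a relation between the coefficients of those
  polytopes that meet a given closed convex set. As the greedy algorithm maximises all \<open>y(A)\<close> with \<open>A\<close> in a
  chain simultaneously, this isolates the polytopes with prescribed values \<open>f(X\<^sub>j) = r\<^sub>j\<close>. All of these
  are contained in \<open>R(X, r)\<close>, which contradicts the choice of an inclusion-minimal \<open>R(X, r)\<close> with nonzero
  coefficient, since the inequalities defining \<open>\<pp>\<close> make \<open>(X, r)\<close> recoverable from \<open>f\<close>.

  Spanning. For a point \<open>y\<close> with \<open>y(B) \<le> rk(B)\<close>, the sets \<open>A \<subseteq> B\<close> all of whose subsets obey their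
  constraint form a cone or a full simplex, so their alternating sum vanishes. Inductively, the
  indicator function of \<open>Q(rk)\<close> is an integral combination of indicator functions of regions
  cut out by the constraints of a chain, and discarding redundant constraints turns each nonempty one
  into some \<open>R(X, r)\<close> with \<open>(X, r)\<close> in \<open>\<pp>\<close>.\<close>

subsection \<open>Additivity of the Euler characteristic on compact convex sets\<close>

text \<open>The indicator of a nonempty interval \<open>[a, b]\<close> minus its limit from the
  right is 1 at \<open>b\<close> and 0 elsewhere. So the coefficients of the nonempty intervals
  ending at a given point sum to zero, and summing over all right endpoints gives the claim.\<close>

lemma interval_indicators_sum_zero:
  fixes c :: "'i \<Rightarrow> int" and S :: "'i \<Rightarrow> real set"
  assumes fin: "finite I" and int: "\<And>i. i \<in> I \<Longrightarrow> \<exists>a b. S i = {a..b}"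
    and zero: "\<And>t. (\<Sum>i\<in>I. c i * indicator (S i) t) = 0"
  shows "(\<Sum>i\<in>{i\<in>I. S i \<noteq> {}}. c i) = 0"
proof -
  obtain a b where S: "\<And>i. i \<in> I \<Longrightarrow> S i = {a i..b i}"
    using int by metis
  define J where "J = {i\<in>I. S i \<noteq> {}}"
  have finJ: "finite J" and ab: "\<And>i. i \<in> J \<Longrightarrow> a i \<le> b i"
    using fin S by (auto simp: J_def)
  have zeroJ: "(\<Sum>i\<in>J. c i * indicator (S i) t) = 0" for t
    unfolding zero[of t, symmetric] J_def using fin by (intro sum.mono_neutral_left) auto
  have "(\<Sum>i\<in>{i\<in>J. b i = t}. c i) = 0" for t
  proof -
    define V where "V = {s \<in> a ` J \<union> b ` J. s > t}"
    \<comment> \<open>The default \<open>t + 1\<close> serves when no endpoint exceeds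
      \<open>t\<close>. As no endpoint lies between \<open>t\<close> and the point \<open>s\<close>
      below, evaluating at \<open>s\<close> yields the right limit at \<open>t\<close>.\<close>
    define m where "m = Min (insert (t + 1) V)"
    have finV: "finite V" using finJ by (auto simp: V_def)
    have "m > t" unfolding m_def using finV by (auto simp: V_def)
    define s where "s = (t + m) / 2"
    have s: "t < s" "s < m" using \<open>m > t\<close> by (auto simp: s_def)
    have ms: "x > s" if "x \<in> a ` J \<union> b ` J" "x > t" for x
    proof -
      have "x \<in> V" using that by (simp add: V_def)
      then have "m \<le> x" unfolding m_def using finV by simp
      then show ?thesis using s by simp
    qed
    have "c i * indicator (S i) t - c i * indicator (S i) s = (if b i = t then c i else 0)"
      if i: "i \<in> J" for i
    proof -
      have Si: "S i = {a i..b i}" using S i by (auto simp: J_def)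
      have "a i > s \<or> a i \<le> t" "b i > s \<or> b i \<le> t" using ms i by force+
      then show ?thesis using ab[OF i] s by (auto simp: Si indicator_def)
    qed
    then have "(\<Sum>i\<in>J. if b i = t then c i else 0)
        = (\<Sum>i\<in>J. c i * indicator (S i) t - c i * indicator (S i) s)"
      by (intro sum.cong) auto
    also have "\<dots> = 0" by (simp add: sum_subtractf zeroJ)
    finally show ?thesis using finJ by (simp add: sum.If_cases Int_def)
  qed
  then have "(\<Sum>t\<in>b ` J. \<Sum>i\<in>{i\<in>J. b i = t}. c i) = 0" by simp
  then show ?thesis using sum.image_gen[OF finJ, of c b] by (simp add: J_def)
qed

text \<open>A substitute for \<open>convex\<close>, since \<^typ>\<open>nat \<Rightarrow> real\<close> is not a \<open>real_vector\<close>. A coordinate at which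
  both points are \<^term>\<open>undefined\<close> stays \<^term>\<open>undefined\<close>.\<close>

definition seg_closed :: "(nat \<Rightarrow> real) set \<Rightarrow> bool" where
  "seg_closed C \<longleftrightarrow>
     (\<forall>y\<in>C. \<forall>z\<in>C. \<forall>t\<in>{0..1}. (\<lambda>i. (1 - t) * y i + t * z i) \<in> C)"

lemma rvec_iff: "y \<in> rvec n \<longleftrightarrow> (\<forall>i. i \<notin> {1..n} \<longrightarrow> y i = undefined)"
  by (auto simp: rvec_def PiE_def extensional_def)

lemma continuous_on_fun_upd_point: "continuous_on UNIV (\<lambda>y::nat \<Rightarrow> real. y(m := c))"
proof (rule continuous_on_coordinatewise_then_product)
  fix i show "continuous_on UNIV (\<lambda>y::nat \<Rightarrow> real. (y(m := c)) i)"
    by (cases "i = m") (auto intro!: continuous_intros)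
qed

lemma continuous_on_fun_upd_value: "continuous_on UNIV (\<lambda>t::real. y(m := t))"
proof (rule continuous_on_coordinatewise_then_product)
  fix i show "continuous_on UNIV (\<lambda>t::real. (y(m := t)) i)"
    by (cases "i = m") (auto intro!: continuous_intros)
qed

text \<open>Integrating out one coordinate at a time against the Euler characteristic replaces the
  indicator of a compact convex set by that of its projection.\<close>

lemma compact_convex_indicators_sum_zero:
  fixes c :: "'i \<Rightarrow> int" and C :: "'i \<Rightarrow> (nat \<Rightarrow> real) set"
  assumes "finite I" and "\<And>i. i \<in> I \<Longrightarrow> compact (C i)" and "\<And>i. i \<in> I \<Longrightarrow> seg_closed (C i)"
    and "\<And>i. i \<in> I \<Longrightarrow> C i \<subseteq> rvec n"
    and "\<And>y. (\<Sum>i\<in>I. c i * indicator (C i) y) = 0"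
  shows "(\<Sum>i\<in>{i\<in>I. C i \<noteq> {}}. c i) = 0"
  using assms(2-)
proof (induction n arbitrary: C)
  case 0
  \<comment> \<open>\<open>rvec 0\<close> has a single point, and the relation evaluated there is
    the claim.\<close>
  have "y = (\<lambda>_. undefined)" if "i \<in> I" "y \<in> C i" for i y
    using 0(3)[OF that(1)] that(2) by (auto simp: rvec_iff fun_eq_iff)
  then have "C i \<noteq> {} \<longleftrightarrow> (\<lambda>_. undefined) \<in> C i" if "i \<in> I" for i
    using that by (metis all_not_in_conv)
  then have "(\<Sum>i\<in>{i\<in>I. C i \<noteq> {}}. c i)
      = (\<Sum>i\<in>I. c i * indicator (C i) (\<lambda>_. undefined))"
    using \<open>finite I\<close> by (intro sum.mono_neutral_cong_left) (auto simp: indicator_def split: if_splits)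
  then show ?case using 0(4) by simp
next
  case (Suc n)
  \<comment> \<open>\<open>D i\<close> is the projection of \<open>C i\<close> along the last
    coordinate, which is reset to \<open>undefined\<close> to land in \<open>rvec n\<close>.\<close>
  define D where "D i = (\<lambda>y. y(Suc n := undefined)) ` C i" for i
  have "compact (D i)" if "i \<in> I" for i
    unfolding D_def using Suc.prems(1)[OF that]
    by (intro compact_continuous_image continuous_on_subset[OF continuous_on_fun_upd_point]) auto
  moreover have "seg_closed (D i)" if "i \<in> I" for i
    unfolding seg_closed_def
  proof (intro ballI)
    fix y z and t :: real assume yz: "y \<in> D i" "z \<in> D i" "t \<in> {0..1}"
    then obtain y' z' where y': "y' \<in> C i" "y = y'(Suc n := undefined)"
      and z': "z' \<in> C i" "z = z'(Suc n := undefined)" by (auto simp: D_def)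
    have "(\<lambda>j. (1 - t) * y' j + t * z' j) \<in> C i"
      using Suc.prems(2)[OF that] y' z' yz by (auto simp: seg_closed_def)
    moreover have "(\<lambda>j. (1 - t) * y j + t * z j)
        = (\<lambda>j. (1 - t) * y' j + t * z' j)(Suc n := undefined)"
      by (auto simp: y' z' fun_eq_iff algebra_simps)
    ultimately show "(\<lambda>j. (1 - t) * y j + t * z j) \<in> D i" by (auto simp: D_def)
  qed
  moreover have "D i \<subseteq> rvec n" if "i \<in> I" for i
  proof
    fix y assume "y \<in> D i"
    then obtain z where z: "z \<in> C i" "y = z(Suc n := undefined)" by (auto simp: D_def)
    have "z j = undefined" if "j \<notin> {1..Suc n}" for j
      using Suc.prems(3)[OF \<open>i \<in> I\<close>] z(1) that unfolding rvec_iff subset_iff by blast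
    then show "y \<in> rvec n" unfolding rvec_iff z(2) by (auto simp: le_Suc_eq)
  qed
  moreover have "(\<Sum>i\<in>I. c i * indicator (D i) y) = 0" for y
  proof (cases "y (Suc n) = undefined")
    case True
    \<comment> \<open>\<open>S i\<close> is the fibre of \<open>C i\<close> over \<open>y\<close>, a
      compact interval that is nonempty exactly when \<open>y \<in> D i\<close>. The one-dimensional
      case for the fibres is therefore the relation for the projections at \<open>y\<close>.\<close>
    define S where "S i = {t. y(Suc n := t) \<in> C i}" for i
    have *: "\<exists>a b. S i = {a..b}" if "i \<in> I" for i
    proof -
      have "closed (C i)" by (rule compact_imp_closed[OF Suc.prems(1)[OF that]])
      then have "closed ((\<lambda>t. y(Suc n := t)) -` C i)"
        by (rule closed_vimage[OF _ continuous_on_fun_upd_value])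
      then have "closed (S i)" by (simp add: S_def vimage_def)
      moreover have "bounded (S i)"
      proof (rule bounded_subset)
        show "bounded ((\<lambda>z. z (Suc n)) ` C i)"
          by (intro compact_imp_bounded compact_continuous_image Suc.prems(1) that
              continuous_on_product_then_coordinatewise[OF continuous_on_id])
        show "S i \<subseteq> (\<lambda>z. z (Suc n)) ` C i"
        proof
          fix t assume "t \<in> S i"
          then have "(y(Suc n := t)) (Suc n) \<in> (\<lambda>z. z (Suc n)) ` C i"
            unfolding S_def by blast
          then show "t \<in> (\<lambda>z. z (Suc n)) ` C i" by simp
        qed
      qed
      moreover have "is_interval (S i)"
        unfolding is_interval_1
      proof (intro ballI allI impI)
        fix a b x assume ab: "a \<in> S i" "b \<in> S i" "a \<le> x \<and> x \<le> b"
        show "x \<in> S i"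
        proof (cases "a = b")
          case True
          then have "x = b" using ab by linarith
          then show ?thesis using ab by simp
        next
          case False
          define t where "t = (x - a) / (b - a)"
          have "a < b" using ab False by linarith
          then have "t * (b - a) = x - a" and t: "t \<in> {0..1}"
            using ab by (auto simp: t_def field_simps)
          then have x: "(1 - t) * a + t * b = x" by (simp add: algebra_simps)
          have "(\<lambda>j. (1 - t) * (y(Suc n := a)) j + t * (y(Suc n := b)) j) \<in> C i"
            using Suc.prems(2)[OF that] ab t unfolding seg_closed_def S_def by blast
          moreover have "(\<lambda>j. (1 - t) * (y(Suc n := a)) j + t * (y(Suc n := b)) j) = y(Suc n := x)"
            using x by (auto simp: fun_eq_iff algebra_simps)
          ultimately show ?thesis by (simp add: S_def)
        qed
      qed
      ultimately show ?thesis
        using connected_compact_interval_1 is_interval_connected_1 compact_eq_bounded_closed by metis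
    qed
    have "(\<Sum>i\<in>{i\<in>I. S i \<noteq> {}}. c i) = 0"
      using \<open>finite I\<close> *
    proof (rule interval_indicators_sum_zero)
      show "(\<Sum>i\<in>I. c i * indicator (S i) t) = 0" for t
        using Suc.prems(4)[of "y(Suc n := t)"] unfolding S_def indicator_def mem_Collect_eq .
    qed
    moreover have "y \<in> D i \<longleftrightarrow> S i \<noteq> {}" for i
    proof
      assume "y \<in> D i"
      then obtain z where "z \<in> C i" "y = z(Suc n := undefined)" by (auto simp: D_def)
      then have "z (Suc n) \<in> S i" by (simp add: S_def)
      then show "S i \<noteq> {}" by blast
    next
      assume "S i \<noteq> {}"
      then obtain t where "y(Suc n := t) \<in> C i" by (auto simp: S_def)
      then have "(y(Suc n := t))(Suc n := undefined) \<in> D i" unfolding D_def by (rule imageI)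
      then show "y \<in> D i" using True by (metis fun_upd_triv fun_upd_upd)
    qed
    ultimately show ?thesis
      using sum.inter_filter[OF \<open>finite I\<close>, of c "\<lambda>i. S i \<noteq> {}"]
      by (simp add: indicator_def of_bool_def if_distrib[of "\<lambda>x. _ * x"] cong: if_cong)
  next
    case False
    then have "y \<notin> D i" for i by (auto simp: D_def)
    then show ?thesis by simp
  qed
  ultimately have "(\<Sum>i\<in>{i\<in>I. D i \<noteq> {}}. c i) = 0" by (rule Suc.IH)
  then show ?case by (simp add: D_def)
qed

subsection \<open>Greedy points and chain polytopes in a box\<close>

text \<open>Induction on \<open>card E\<close>: remove a point \<open>e\<close> outside all proper
  members of the chain, solve the problem on the rest \<open>E'\<close>, and give \<open>e\<close>
  the marginal value \<open>f E - f E'\<close>. Sets \<open>A\<close> containing \<open>e\<close>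
  are handled by submodularity for the pair \<open>A\<close>, \<open>E'\<close>.\<close>

lemma greedy_point:
  fixes f :: "'a set \<Rightarrow> 'b::linordered_idom"
  assumes "finite E" and "f {} = 0"
    and "\<And>A B. A \<subseteq> E \<Longrightarrow> B \<subseteq> E \<Longrightarrow> f (A \<union> B) + f (A \<inter> B) \<le> f A + f B"
    and "\<C> \<subseteq> Pow E" and "\<And>A B. A \<in> \<C> \<Longrightarrow> B \<in> \<C> \<Longrightarrow> A \<subseteq> B \<or> B \<subseteq> A"
  shows "\<exists>y. (\<forall>A\<subseteq>E. sum y A \<le> f A) \<and> (\<forall>A\<in>insert E \<C>. sum y A = f A)"
  using assms
proof (induction "card E" arbitrary: E \<C>)
  case 0
  then have "E = {}" "\<C> \<subseteq> {{}}" by auto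
  then show ?case using 0 by (intro exI[of _ "\<lambda>_. 0"]) auto
next
  case (Suc n)
  note sub = Suc.prems(3)
  define U where "U = \<Union>(\<C> - {E})"
  have "U \<subset> E"
  proof (cases "\<C> - {E} = {}")
    case True
    then have "U = {}" unfolding U_def by (metis Union_empty)
    then show ?thesis using Suc.hyps(2) by auto
  next
    case False
    have "finite (\<C> - {E})" using Suc.prems(1,4) finite_subset by blast
    moreover have "subset.chain UNIV (\<C> - {E})"
      using Suc.prems(5) by (auto simp: subset.chain_def)
    \<comment> \<open>The union of a nonempty finite chain is its largest member, here a proper
      subset of \<open>E\<close>.\<close>
    ultimately have "U \<in> \<C> - {E}"
      unfolding U_def using False by (intro Union_in_chain)
    then show ?thesis using Suc.prems(4) by blast
  qed
  then obtain e where e: "e \<in> E" "e \<notin> U" by blast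
  define E' where "E' = E - {e}"
  define \<D> where "\<D> = insert E' (\<C> - {E})"
  have E: "E = insert e E'" "e \<notin> E'" "finite E'" "E' \<subseteq> E" "n = card E'"
    using e Suc.prems(1) Suc.hyps(2) by (auto simp: E'_def)
  have below: "A \<subseteq> E'" if "A \<in> \<C> - {E}" for A
    using that e Suc.prems(4) by (auto simp: U_def E'_def)
  have "\<exists>y. (\<forall>A\<subseteq>E'. sum y A \<le> f A) \<and> (\<forall>A\<in>insert E' \<D>. sum y A = f A)"
  proof (rule Suc.hyps(1)[OF E(5) E(3) Suc.prems(2)])
    show "f (A \<union> B) + f (A \<inter> B) \<le> f A + f B" if "A \<subseteq> E'" "B \<subseteq> E'" for A B
      using sub[of A B] that E(4) by blast
    show "\<D> \<subseteq> Pow E'" using below by (auto simp: \<D>_def)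
    show "A \<subseteq> B \<or> B \<subseteq> A" if "A \<in> \<D>" "B \<in> \<D>" for A B
      using that below Suc.prems(5) unfolding \<D>_def by blast
  qed
  then obtain y where y: "\<And>A. A \<subseteq> E' \<Longrightarrow> sum y A \<le> f A" "\<And>A. A \<in> \<D> \<Longrightarrow> sum y A = f A"
    by blast
  define z where "z = y(e := f E - f E')"
  have z_same: "sum z A = sum y A" if "e \<notin> A" for A
    unfolding z_def using that by (intro sum.cong) auto
  have z_ins: "sum z (insert e A) = f E - f E' + sum y A" if "A \<subseteq> E'" for A
  proof -
    have "finite A" "e \<notin> A" using that E finite_subset by auto
    then show ?thesis using z_same[of A] by (simp add: z_def)
  qed
  show ?case
  proof (intro exI conjI allI impI ballI)
    fix A assume A: "A \<subseteq> E"
    show "sum z A \<le> f A"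
    proof (cases "e \<in> A")
      case True
      define A' where "A' = A - {e}"
      have A': "A = insert e A'" "A' \<subseteq> E'" using True A by (auto simp: A'_def E'_def)
      have un: "A \<union> E' = E" "A \<inter> E' = A'" using True A by (auto simp: A'_def E'_def)
      have "f E + f A' \<le> f A + f E'" using sub[OF A E(4)] un by simp
      then show ?thesis using z_ins[OF A'(2)] y(1)[OF A'(2)] A'(1) by simp
    next
      case False
      then show ?thesis using A y(1)[of A] z_same[of A] by (auto simp: E'_def)
    qed
  next
    fix A assume A: "A \<in> insert E \<C>"
    show "sum z A = f A"
    proof (cases "A = E")
      case True
      then show ?thesis using z_ins[of E'] y(2)[of E'] E by (simp add: \<D>_def)
    next
      case False
      then have "A \<in> \<C> - {E}" using A by blast
      then show ?thesis using below[of A] E(2) z_same[of A] y(2)[of A] by (auto simp: \<D>_def)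
    qed
  qed
qed

lemma closed_sum_constraint:
  "closed {y::nat \<Rightarrow> real. c \<le> (\<Sum>i\<in>A. y i)}" "closed {y::nat \<Rightarrow> real. (\<Sum>i\<in>A. y i) \<le> c}"
  by (intro closed_Collect_le continuous_intros
      continuous_on_product_then_coordinatewise[OF continuous_on_id])+

text \<open>\<open>lower\<close> and \<open>upper\<close> say that every increment of
  \<open>\<rho>\<close> along the chain is compatible with coordinates in \<open>[l, u]\<close>.
  They make \<open>\<rho> j\<close> the exact maximum of \<open>y(X j)\<close> over
  \<open>polytope\<close>, and not just an upper bound.\<close>

locale box_chain =
  fixes d :: nat and l u :: int and k :: nat and X :: "nat \<Rightarrow> nat set" and \<rho> :: "nat \<Rightarrow> int"
  assumes l_less_u: "l < u"
    and X_0: "X 0 = {}" and X_k: "X k = {1..d}"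
    and X_mono: "\<And>i j. i < j \<Longrightarrow> j \<le> k \<Longrightarrow> X i \<subset> X j"
    and \<rho>_0: "\<rho> 0 = 0"
    and lower: "\<And>i j. i < j \<Longrightarrow> j \<le> k \<Longrightarrow> l * int (card (X j - X i)) \<le> \<rho> j - \<rho> i"
    and upper: "\<And>i j. i < j \<Longrightarrow> j \<le> k \<Longrightarrow> \<rho> j - \<rho> i \<le> u * int (card (X j - X i))"
begin

text \<open>\<open>bound j A\<close> bounds \<open>y(A) = y(X j) + y(A - X j) - y(X j - A)\<close> from above.\<close>

definition bound where
  "bound j A = \<rho> j + u * int (card (A - X j)) - l * int (card (X j - A))"

definition rk :: "nat set \<Rightarrow> int" where
  "rk A = Min ((\<lambda>j. bound j A) ` {..k})"

definition polytope :: "(nat \<Rightarrow> real) set" where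
  "polytope = {y \<in> rvec d. (\<forall>i\<in>{1..d}. of_int l \<le> y i \<and> y i \<le> of_int u) \<and>
     (\<Sum>i\<in>{1..d}. y i) = of_int (\<rho> k) \<and> (\<forall>j\<le>k. (\<Sum>i\<in>X j. y i) \<le> of_int (\<rho> j))}"

lemma X_le: "i \<le> j \<Longrightarrow> j \<le> k \<Longrightarrow> X i \<subseteq> X j"
  using X_mono[of i j] by (cases "i = j") auto

lemma X_sub: "j \<le> k \<Longrightarrow> X j \<subseteq> {1..d}"
  using X_le[of j k] X_k by simp

lemma finite_X: "j \<le> k \<Longrightarrow> finite (X j)"
  using X_sub finite_subset by blast

lemma rk_le_bound: "j \<le> k \<Longrightarrow> rk A \<le> bound j A"
  unfolding rk_def by (intro Min_le) auto

lemma rk_attained: obtains j where "j \<le> k" "rk A = bound j A"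
proof -
  have "rk A \<in> (\<lambda>j. bound j A) ` {..k}" unfolding rk_def by (intro Min_in) auto
  then show ?thesis using that by auto
qed

text \<open>An index before \<open>j\<close> cannot give a smaller bound by \<open>upper\<close>,
  and an index after \<open>j\<close> cannot by \<open>lower\<close>.\<close>

lemma rk_X: assumes "j \<le> k" shows "rk (X j) = \<rho> j"
proof (rule antisym)
  show "rk (X j) \<le> \<rho> j" using rk_le_bound[OF assms, of "X j"] by (simp add: bound_def)
  obtain i where i: "i \<le> k" "rk (X j) = bound i (X j)" by (rule rk_attained)
  consider "i < j" | "i = j" | "j < i" by linarith
  then show "\<rho> j \<le> rk (X j)"
  proof cases
    case 1
    then have "X i - X j = {}" using X_le[of i j] assms by auto
    then have "card (X i - X j) = 0" by (simp only: card.empty)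
    then show ?thesis using upper[OF 1 assms] unfolding i(2) bound_def by simp
  next
    case 2 then show ?thesis using i(2) by (simp add: bound_def)
  next
    case 3
    then have "X j - X i = {}" using X_le[of j i] i(1) by auto
    then have "card (X j - X i) = 0" by (simp only: card.empty)
    then show ?thesis using lower[OF 3 i(1)] unfolding i(2) bound_def by simp
  qed
qed

lemma rk_empty: "rk {} = 0"
  using rk_X[of 0] X_0 \<rho>_0 by simp

lemma rk_ground: "rk {1..d} = \<rho> k"
  using rk_X[of k] X_k by simp

text \<open>Separates a part modular in \<open>A\<close> from
  \<open>(u - l) * card (A \<inter> X j)\<close>, so that submodularity becomes a statement about
  sizes of intersections.\<close>

lemma bound_eq:
  assumes "j \<le> k" "finite A"
  shows "bound j A = \<rho> j + u * int (card A) - l * int (card (X j)) - (u - l) * int (card (A \<inter> X j))"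
proof -
  have *: "int (card (A - X j)) = int (card A) - int (card (A \<inter> X j))"
    "int (card (X j - A)) = int (card (X j)) - int (card (A \<inter> X j))"
    using card_Diff_subset_Int[of A "X j"] card_Diff_subset_Int[of "X j" A] assms finite_X[of j]
    by (auto simp: Int_commute card_mono of_nat_diff)
  show ?thesis unfolding bound_def * by (simp add: algebra_simps)
qed

text \<open>With the smaller index at the intersection, \<open>X i \<subseteq> X j\<close> shows
  that the total size of the intersections with the chain members can only grow; it enters with the
  negative factor \<open>-(u - l)\<close>.\<close>

lemma bound_submodular:
  assumes "i \<le> j" "j \<le> k" "finite A" "finite B"
  shows "bound i (A \<inter> B) + bound j (A \<union> B) \<le> bound i A + bound j B"
proof -
  have "card (A \<inter> X i) + card (B \<inter> X j)
      = card ((A \<inter> X i) \<union> (B \<inter> X j)) + card ((A \<inter> X i) \<inter> (B \<inter> X j))"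
    using assms by (intro card_Un_Int) auto
  also have "\<dots> \<le> card ((A \<union> B) \<inter> X j) + card (A \<inter> B \<inter> X i)"
    using X_le[OF assms(1,2)] assms(3,4) by (intro add_mono card_mono) auto
  finally have "(u - l) * int (card (A \<inter> X i) + card (B \<inter> X j))
      \<le> (u - l) * int (card ((A \<union> B) \<inter> X j) + card (A \<inter> B \<inter> X i))"
    using l_less_u by (intro mult_left_mono) auto
  moreover have "u * int (card A + card B) = u * int (card (A \<union> B) + card (A \<inter> B))"
    using card_Un_Int[OF assms(3,4)] by simp
  ultimately show ?thesis
    using assms by (simp add: bound_eq algebra_simps)
qed

lemma rk_submodular:
  assumes "finite A" "finite B"
  shows "rk (A \<union> B) + rk (A \<inter> B) \<le> rk A + rk B"
proof -
  obtain i where i: "i \<le> k" "rk A = bound i A" by (rule rk_attained)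
  obtain j where j: "j \<le> k" "rk B = bound j B" by (rule rk_attained)
  show ?thesis
  proof (cases "i \<le> j")
    case True
    then show ?thesis
      using bound_submodular[OF True j(1) assms] rk_le_bound[OF i(1), of "A \<inter> B"]
        rk_le_bound[OF j(1), of "A \<union> B"] i j by linarith
  next
    case False
    then show ?thesis
      using bound_submodular[of j i B A] rk_le_bound[OF j(1), of "A \<inter> B"] assms
        rk_le_bound[OF i(1), of "A \<union> B"] i j by (simp add: Un_commute Int_commute)
  qed
qed

lemma polytope_sum_le_rk:
  assumes y: "y \<in> polytope" and A: "A \<subseteq> {1..d}"
  shows "(\<Sum>i\<in>A. y i) \<le> of_int (rk A)"
proof -
  obtain j where j: "j \<le> k" "rk A = bound j A" by (rule rk_attained)
  have fin: "finite A" "finite (X j)" using A finite_subset finite_X[OF j(1)] by auto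
  have "(\<Sum>i\<in>A - X j. y i) \<le> of_nat (card (A - X j)) * of_int u"
    using y A by (intro sum_bounded_above) (auto simp: polytope_def)
  moreover have "of_nat (card (X j - A)) * of_int l \<le> (\<Sum>i\<in>X j - A. y i)"
    using y X_sub[OF j(1)] by (intro sum_bounded_below) (auto simp: polytope_def)
  moreover have "(\<Sum>i\<in>X j. y i) \<le> of_int (\<rho> j)" using y j by (auto simp: polytope_def)
  moreover have "(\<Sum>i\<in>A. y i) = (\<Sum>i\<in>A \<inter> X j. y i) + (\<Sum>i\<in>A - X j. y i)"
    "(\<Sum>i\<in>X j. y i) = (\<Sum>i\<in>A \<inter> X j. y i) + (\<Sum>i\<in>X j - A. y i)"
    using sum.Int_Diff[of A y "X j"] sum.Int_Diff[of "X j" y A] fin by (auto simp: Int_commute)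
  moreover have "real_of_int (rk A)
      = of_int (\<rho> j) + of_nat (card (A - X j)) * of_int u - of_nat (card (X j - A)) * of_int l"
    unfolding j(2) bound_def by simp
  ultimately show ?thesis by linarith
qed

text \<open>The box constraints are recovered from \<open>rk {i} \<le> u\<close> and
  \<open>rk ({1..d} - {i}) \<le> \<rho> k - l\<close>, the latter combined with the fixed total
  sum.\<close>

lemma polytope_eq_base:
  "polytope = {y \<in> rvec d. (\<Sum>i\<in>{1..d}. y i) = of_int (rk {1..d}) \<and>
     (\<forall>A\<subseteq>{1..d}. (\<Sum>i\<in>A. y i) \<le> of_int (rk A))}" (is "_ = ?R")
proof
  show "polytope \<subseteq> ?R"
    using polytope_sum_le_rk rk_ground by (auto simp: polytope_def)
  show "?R \<subseteq> polytope"
  proof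
    fix y assume "y \<in> ?R"
    then have y: "y \<in> rvec d" "(\<Sum>i\<in>{1..d}. y i) = of_int (\<rho> k)"
      "\<And>A. A \<subseteq> {1..d} \<Longrightarrow> (\<Sum>i\<in>A. y i) \<le> of_int (rk A)" using rk_ground by auto
    have "of_int l \<le> y i" "y i \<le> of_int u" if i: "i \<in> {1..d}" for i
    proof -
      have "bound 0 {i} = u" by (simp add: bound_def X_0 \<rho>_0)
      then have "rk {i} \<le> u" using rk_le_bound[of 0 "{i}"] by simp
      then have "real_of_int (rk {i}) \<le> of_int u" by simp
      then show "y i \<le> of_int u" using y(3)[of "{i}"] i by simp
      have "{1..d} - ({1..d} - {i}) = {i}" using i by auto
      then have "bound k ({1..d} - {i}) = \<rho> k - l"
        by (simp add: bound_def X_k)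
      then have "rk ({1..d} - {i}) \<le> \<rho> k - l" using rk_le_bound[of k "{1..d} - {i}"] by simp
      then have "real_of_int (rk ({1..d} - {i})) \<le> of_int (\<rho> k) - of_int l" by linarith
      moreover have "(\<Sum>j\<in>{1..d}. y j) = y i + (\<Sum>j\<in>{1..d} - {i}. y j)"
        using i by (intro sum.remove) auto
      ultimately show "of_int l \<le> y i" using y(2) y(3)[of "{1..d} - {i}"] by auto
    qed
    moreover have "(\<Sum>i\<in>X j. y i) \<le> of_int (\<rho> j)" if "j \<le> k" for j
      using y(3)[OF X_sub[OF that]] rk_X[OF that] by simp
    ultimately show "y \<in> polytope" using y(1,2) by (auto simp: polytope_def)
  qed
qed

lemma polytope_attains:
  assumes "\<C> \<subseteq> Pow {1..d}" and "\<And>A B. A \<in> \<C> \<Longrightarrow> B \<in> \<C> \<Longrightarrow> A \<subseteq> B \<or> B \<subseteq> A"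
  obtains y where "y \<in> polytope" "\<And>A. A \<in> \<C> \<Longrightarrow> (\<Sum>i\<in>A. y i) = of_int (rk A)"
proof -
  have "\<exists>y. (\<forall>A\<subseteq>{1..d}. sum y A \<le> rk A) \<and> (\<forall>A\<in>insert {1..d} \<C>. sum y A = rk A)"
    using assms by (intro greedy_point rk_empty rk_submodular) (auto intro: finite_subset)
  then obtain y where y: "\<And>A. A \<subseteq> {1..d} \<Longrightarrow> sum y A \<le> rk A"
      "\<And>A. A \<in> insert {1..d} \<C> \<Longrightarrow> sum y A = rk A" by blast
  define z where "z = restrict (\<lambda>i. real_of_int (y i)) {1..d}"
  have z: "(\<Sum>i\<in>A. z i) = of_int (sum y A)" if "A \<subseteq> {1..d}" for A
    unfolding of_int_sum z_def using that by (intro sum.cong) auto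
  show ?thesis
  proof
    have "z \<in> rvec d" by (auto simp: z_def rvec_def)
    moreover have "(\<Sum>i\<in>A. z i) \<le> of_int (rk A)" if "A \<subseteq> {1..d}" for A
      unfolding z[OF that] using y(1)[OF that] by (simp only: of_int_le_iff)
    moreover have "(\<Sum>i\<in>{1..d}. z i) = of_int (rk {1..d})"
      unfolding z[OF subset_refl] using y(2)[of "{1..d}"] by simp
    ultimately show "z \<in> polytope" by (simp add: polytope_eq_base)
    show "(\<Sum>i\<in>A. z i) = of_int (rk A)" if "A \<in> \<C>" for A
      using that z[of A] y(2)[of A] assms(1) by auto
  qed
qed

text \<open>One greedy point maximises all \<open>y(A)\<close> with \<open>A\<close> in the chain at
  once, so the halfspaces can be tested one by one.\<close>

lemma polytope_meets_iff:
  assumes "J \<subseteq> Pow {1..d}" and "\<And>A B. A \<in> J \<Longrightarrow> B \<in> J \<Longrightarrow> A \<subseteq> B \<or> B \<subseteq> A"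
  shows "polytope \<inter> {y. \<forall>A\<in>J. of_int (s A) \<le> (\<Sum>i\<in>A. y i)} \<noteq> {} \<longleftrightarrow> (\<forall>A\<in>J. s A \<le> rk A)"
proof
  assume "polytope \<inter> {y. \<forall>A\<in>J. of_int (s A) \<le> (\<Sum>i\<in>A. y i)} \<noteq> {}"
  then obtain y where y: "y \<in> polytope" "\<And>A. A \<in> J \<Longrightarrow> of_int (s A) \<le> (\<Sum>i\<in>A. y i)" by blast
  show "\<forall>A\<in>J. s A \<le> rk A"
  proof
    fix A assume A: "A \<in> J"
    then have "real_of_int (s A) \<le> of_int (rk A)"
      using polytope_sum_le_rk[OF y(1), of A] y(2)[OF A] assms(1) by force
    then show "s A \<le> rk A" by simp
  qed
next
  assume *: "\<forall>A\<in>J. s A \<le> rk A"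
  obtain y where "y \<in> polytope" "\<And>A. A \<in> J \<Longrightarrow> (\<Sum>i\<in>A. y i) = of_int (rk A)"
    using polytope_attains[OF assms] by blast
  then show "polytope \<inter> {y. \<forall>A\<in>J. of_int (s A) \<le> (\<Sum>i\<in>A. y i)} \<noteq> {}" using * by auto
qed

lemma compact_polytope: "compact polytope"
proof -
  \<comment> \<open>The factor \<open>{undefined}\<close> outside \<open>{1..d}\<close> makes the
    box in \<open>rvec d\<close> a product of compact sets, to which Tychonoff's theorem
    applies.\<close>
  define B where "B = PiE UNIV (\<lambda>i. if i \<in> {1..d} then {real_of_int l..of_int u} else {undefined})"
  have "compact B"
  proof -
    have "compactin (product_topology (\<lambda>i. euclidean) UNIV) B"
      unfolding B_def compactin_PiE by auto
    then show ?thesis by (simp add: euclidean_product_topology)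
  qed
  moreover have "polytope = B \<inter> ({y. of_int (\<rho> k) \<le> (\<Sum>i\<in>{1..d}. y i)} \<inter>
      {y. (\<Sum>i\<in>{1..d}. y i) \<le> of_int (\<rho> k)} \<inter> (\<Inter>j\<in>{..k}. {y. (\<Sum>i\<in>X j. y i) \<le> of_int (\<rho> j)}))"
    by (force simp: polytope_def B_def rvec_iff PiE_iff split: if_splits)
  ultimately show ?thesis
    by (auto intro!: compact_Int_closed closed_Int closed_INT closed_sum_constraint)
qed

end

lemma convex_comb_sum:
  "(\<Sum>i\<in>A. (1 - t) * y i + t * z i) = (1 - t) * (\<Sum>i\<in>A. y i) + t * (\<Sum>i\<in>A. z i::real)"
  by (simp add: sum.distrib sum_distrib_left)

lemma convex_comb_bounds:
  fixes a b c t :: real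
  assumes "t \<in> {0..1}"
  shows "c \<le> a \<Longrightarrow> c \<le> b \<Longrightarrow> c \<le> (1 - t) * a + t * b"
    and "a \<le> c \<Longrightarrow> b \<le> c \<Longrightarrow> (1 - t) * a + t * b \<le> c"
proof -
  show "c \<le> (1 - t) * a + t * b" if "c \<le> a" "c \<le> b"
    using convex_bound_le[of "-a" "-c" "-b" "1 - t" t] that assms by simp
  show "(1 - t) * a + t * b \<le> c" if "a \<le> c" "b \<le> c"
    using convex_bound_le[of a c b "1 - t" t] that assms by simp
qed

lemma (in box_chain) seg_closed_polytope_Int:
  "seg_closed (polytope \<inter> {y. \<forall>A\<in>J. of_int (s A) \<le> (\<Sum>i\<in>A. y i)})"
  unfolding seg_closed_def
proof (intro ballI)
  fix y z and t :: real
  assume y: "y \<in> polytope \<inter> {y. \<forall>A\<in>J. of_int (s A) \<le> (\<Sum>i\<in>A. y i)}"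
    and z: "z \<in> polytope \<inter> {y. \<forall>A\<in>J. of_int (s A) \<le> (\<Sum>i\<in>A. y i)}" and t: "t \<in> {0..1}"
  define w where "w = (\<lambda>i. (1 - t) * y i + t * z i)"
  have sum_w: "(\<Sum>i\<in>A. w i) = (1 - t) * (\<Sum>i\<in>A. y i) + t * (\<Sum>i\<in>A. z i)" for A
    unfolding w_def by (rule convex_comb_sum)
  have "w \<in> rvec d"
    using y z by (auto simp: polytope_def rvec_iff w_def algebra_simps)
  moreover have "of_int l \<le> w i \<and> w i \<le> of_int u" if "i \<in> {1..d}" for i
    using y z that unfolding w_def polytope_def by (auto intro!: convex_comb_bounds t)
  moreover have "(\<Sum>i\<in>{1..d}. w i) = of_int (\<rho> k)"
    using y z unfolding sum_w by (simp add: polytope_def algebra_simps)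
  moreover have "(\<Sum>i\<in>X j. w i) \<le> of_int (\<rho> j)" if "j \<le> k" for j
    using y z that unfolding sum_w polytope_def by (auto intro!: convex_comb_bounds t)
  moreover have "of_int (s A) \<le> (\<Sum>i\<in>A. w i)" if "A \<in> J" for A
    using y z that unfolding sum_w by (auto intro!: convex_comb_bounds t)
  ultimately have "w \<in> polytope \<inter> {y. \<forall>A\<in>J. of_int (s A) \<le> (\<Sum>i\<in>A. y i)}"
    by (simp add: polytope_def)
  then show "(\<lambda>i. (1 - t) * y i + t * z i) \<in> polytope \<inter> {y. \<forall>A\<in>J. of_int (s A) \<le> (\<Sum>i\<in>A. y i)}"
    by (simp add: w_def)
qed

subsection \<open>Linear independence\<close>

text \<open>Equality stays possible in \<open>lower\<close> at \<open>i = 0\<close> and in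
  \<open>upper\<close> at \<open>j = k\<close>, matching \<open>0 \<le> r_1\<close> and the weak
  last inequality of \<open>p_M\<close>. The chain is still determined, since \<open>X 0\<close> and
  \<open>X k\<close> are common to all chains.\<close>

locale strict_box_chain = box_chain +
  assumes strict_lower: "\<And>i j. 1 \<le> i \<Longrightarrow> i < j \<Longrightarrow> j \<le> k \<Longrightarrow> l * int (card (X j - X i)) < \<rho> j - \<rho> i"
    and strict_upper: "\<And>i j. i < j \<Longrightarrow> j < k \<Longrightarrow> \<rho> j - \<rho> i < u * int (card (X j - X i))"
begin

text \<open>For matroids the next two lemmas say that the proper members of the chain are cyclic flats.\<close>

lemma rk_insert:
  assumes j: "1 \<le> j" "j < k" and e: "e \<in> {1..d} - X j"
  shows "\<rho> j + l < rk (insert e (X j))"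
proof -
  obtain i where i: "i \<le> k" "rk (insert e (X j)) = bound i (insert e (X j))" by (rule rk_attained)
  have fin: "finite (X i)" "finite (X j)" using finite_X i j by auto
  show ?thesis
  proof (cases "i \<le> j")
    case True
    then have sub: "X i \<subseteq> X j" using X_le j by simp
    then have "X i - insert e (X j) = {}" "insert e (X j) - X i = insert e (X j - X i)" using e by auto
    then have "bound i (insert e (X j)) = \<rho> i + u * int (card (X j - X i)) + u"
      using e fin by (simp add: bound_def algebra_simps)
    moreover have "\<rho> j - \<rho> i \<le> u * int (card (X j - X i))"
      using upper[of i j] True j by (cases "i = j") auto
    ultimately show ?thesis using i(2) l_less_u by simp
  next
    case False
    then have ji: "j < i" by simp
    then have sub: "X j \<subseteq> X i" using X_le i by simp
    show ?thesis
    proof (cases "e \<in> X i")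
      case True
      then have eq: "insert e (X j) - X i = {}" "X i - insert e (X j) = X i - X j - {e}" using sub by auto
      have "e \<in> X i - X j" using True e by simp
      then have "int (card (X i - X j - {e})) = int (card (X i - X j)) - 1"
        using fin card_Suc_Diff1[of "X i - X j" e] by simp
      then have "bound i (insert e (X j)) = \<rho> i - l * (int (card (X i - X j)) - 1)"
        unfolding bound_def eq by simp
      then show ?thesis
        using strict_lower[OF j(1) ji i(1)] i(2) by (simp add: algebra_simps)
    next
      case False
      then have eq: "insert e (X j) - X i = {e}" "X i - insert e (X j) = X i - X j" using sub by auto
      have "bound i (insert e (X j)) = \<rho> i + u - l * int (card (X i - X j))"
        unfolding bound_def eq by simp
      then show ?thesis using lower[OF ji i(1)] i(2) l_less_u by simp
    qed
  qed
qed

lemma rk_remove: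
  assumes j: "j < k" and e: "e \<in> X j"
  shows "\<rho> j - u < rk (X j - {e})"
proof -
  obtain i where i: "i \<le> k" "rk (X j - {e}) = bound i (X j - {e})" by (rule rk_attained)
  have fin: "finite (X i)" "finite (X j)" using finite_X i j by auto
  show ?thesis
  proof (cases "j \<le> i")
    case True
    then have sub: "X j \<subseteq> X i" using X_le i by simp
    then have eq: "X i - (X j - {e}) = insert e (X i - X j)" "X j - {e} - X i = {}" using e by auto
    have "bound i (X j - {e}) = \<rho> i - l * int (card (X i - X j)) - l"
      unfolding bound_def eq using e fin by (simp add: algebra_simps)
    moreover have "l * int (card (X i - X j)) \<le> \<rho> i - \<rho> j"
      using lower[of j i] True i by (cases "i = j") auto
    ultimately show ?thesis using i(2) l_less_u by simp
  next
    case False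
    then have ij: "i < j" by simp
    then have sub: "X i \<subseteq> X j" using X_le j by simp
    show ?thesis
    proof (cases "e \<in> X i")
      case True
      then have eq: "X i - (X j - {e}) = {e}" "X j - {e} - X i = X j - X i" using sub by auto
      have "bound i (X j - {e}) = \<rho> i + u * int (card (X j - X i)) - l"
        unfolding bound_def eq by simp
      then show ?thesis using upper[OF ij] j i(2) l_less_u by simp
    next
      case False
      then have eq: "X i - (X j - {e}) = {}" "X j - {e} - X i = X j - X i - {e}" using sub by auto
      have "e \<in> X j - X i" using False e by simp
      then have "int (card (X j - X i - {e})) = int (card (X j - X i)) - 1"
        using fin card_Suc_Diff1[of "X j - X i" e] by simp
      then have "bound i (X j - {e}) = \<rho> i + u * (int (card (X j - X i)) - 1)"
        unfolding bound_def eq by simp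
      then show ?thesis using strict_upper[OF ij j] i(2) by (simp add: algebra_simps)
    qed
  qed
qed

text \<open>If the other chain attains \<open>rk (X j)\<close> at index \<open>i\<close>, then
  inserting a point of \<open>X' i - X j\<close> raises that bound by only \<open>l\<close>, and
  removing a point of \<open>X j - X' i\<close> lowers it by \<open>u\<close>. Both contradict the
  strict inequalities of \<open>rk_insert\<close> and \<open>rk_remove\<close>, so
  \<open>X j = X' i\<close>.\<close>

lemma X_in_chain_of_rk:
  assumes "box_chain d l u k' X' \<rho>'" and j: "j \<le> k"
    and rk_eq: "\<And>A. A \<subseteq> {1..d} \<Longrightarrow> rk A = box_chain.rk l u k' X' \<rho>' A"
  shows "X j \<in> X' ` {..k'}"
proof -
  interpret T: box_chain d l u k' X' \<rho>' by fact
  consider "j = 0" | "j = k" | "1 \<le> j" "j < k" using j by linarith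
  then show ?thesis
  proof cases
    case 1 then show ?thesis using X_0 T.X_0 by auto
  next
    case 2 then show ?thesis using X_k T.X_k by auto
  next
    case 3
    note sub = X_sub[OF j]
    obtain i where i: "i \<le> k'" "T.rk (X j) = T.bound i (X j)" by (rule T.rk_attained)
    have fin: "finite (X' i)" "finite (X j)" using T.finite_X i finite_X j by auto
    have \<rho>j: "\<rho> j = T.bound i (X j)" using i(2) rk_eq[OF sub] rk_X[OF j] by simp
    have "X' i \<subseteq> X j"
    proof
      fix e assume e: "e \<in> X' i"
      show "e \<in> X j"
      proof (rule ccontr)
        assume "e \<notin> X j"
        then have e': "e \<in> {1..d} - X j" "e \<in> X' i - X j" using e T.X_sub[OF i(1)] by auto
        have eq: "insert e (X j) - X' i = X j - X' i" "X' i - insert e (X j) = X' i - X j - {e}"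
          using e by auto
        have c: "int (card (X' i - X j - {e})) = int (card (X' i - X j)) - 1"
          using fin e' card_Suc_Diff1[of "X' i - X j" e] by simp
        then have "T.bound i (insert e (X j)) = T.bound i (X j) + l"
          unfolding T.bound_def eq c by (simp add: algebra_simps)
        moreover have "rk (insert e (X j)) = T.rk (insert e (X j))"
          using sub e' by (intro rk_eq) auto
        ultimately show False
          using rk_insert[OF 3 e'(1)] T.rk_le_bound[OF i(1), of "insert e (X j)"] \<rho>j by simp
      qed
    qed
    moreover have "X j \<subseteq> X' i"
    proof
      fix e assume e: "e \<in> X j"
      show "e \<in> X' i"
      proof (rule ccontr)
        assume "e \<notin> X' i"
        then have e': "e \<in> X j - X' i"
          and eq: "X' i - (X j - {e}) = X' i - X j" "X j - {e} - X' i = X j - X' i - {e}"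
          using e by auto
        have c: "int (card (X j - X' i - {e})) = int (card (X j - X' i)) - 1"
          using fin e' card_Suc_Diff1[of "X j - X' i" e] by simp
        then have "T.bound i (X j - {e}) = T.bound i (X j) - u"
          unfolding T.bound_def eq c by (simp add: algebra_simps)
        moreover have "rk (X j - {e}) = T.rk (X j - {e})"
          using sub by (intro rk_eq) auto
        ultimately show False
          using rk_remove[OF 3(2) e] T.rk_le_bound[OF i(1), of "X j - {e}"] \<rho>j by simp
      qed
    qed
    ultimately show ?thesis using i(1) by blast
  qed
qed

end

section \<open>Reconstruction of a chain and its vector from the rank function\<close>

lemma sorted_wrt_psubset_unique:
  assumes "sorted_wrt (\<subset>) xs" "sorted_wrt (\<subset>) ys" "set xs = set ys"
  shows "xs = ys"
  using assms
proof (induction xs arbitrary: ys)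
  case Nil
  then show ?case by simp
next
  case (Cons x xs)
  then obtain y ys' where ys: "ys = y # ys'" by (cases ys) auto
  have "x = y \<or> x \<in> set ys'" "y = x \<or> y \<in> set xs" using Cons.prems(3) ys by auto
  then have "x = y" using Cons.prems(1,2) ys by auto
  moreover have "x \<notin> set xs" "y \<notin> set ys'" using Cons.prems(1,2) ys by auto
  then have "set xs = set ys'" using Cons.prems(3) ys \<open>x = y\<close> by auto
  ultimately show ?case using Cons ys by auto
qed

abbreviation box_chain_list :: "nat \<Rightarrow> int \<Rightarrow> int \<Rightarrow> nat set list \<times> int list \<Rightarrow> bool" where
  "box_chain_list d l u Z \<equiv> box_chain d l u (length (fst Z)) (Xset (fst Z)) (rval (snd Z))"

abbreviation strict_box_chain_list :: "nat \<Rightarrow> int \<Rightarrow> int \<Rightarrow> nat set list \<times> int list \<Rightarrow> bool" where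
  "strict_box_chain_list d l u Z \<equiv>
     strict_box_chain d l u (length (fst Z)) (Xset (fst Z)) (rval (snd Z))"

abbreviation chain_polytope :: "nat \<Rightarrow> int \<Rightarrow> int \<Rightarrow> nat set list \<times> int list \<Rightarrow> (nat \<Rightarrow> real) set" where
  "chain_polytope d l u Z \<equiv> box_chain.polytope d l u (length (fst Z)) (Xset (fst Z)) (rval (snd Z))"

abbreviation chain_rk :: "int \<Rightarrow> int \<Rightarrow> nat set list \<times> int list \<Rightarrow> nat set \<Rightarrow> int" where
  "chain_rk l u Z \<equiv> box_chain.rk l u (length (fst Z)) (Xset (fst Z)) (rval (snd Z))"

text \<open>The rank function determines the chain as a set, hence as a sorted list, and then the
  vector through \<open>rk_X\<close>.\<close>

lemma strict_box_chain_list_eq: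
  assumes Z: "strict_box_chain_list d l u Z" "length (snd Z) = length (fst Z)"
    and Z': "strict_box_chain_list d l u Z'" "length (snd Z') = length (fst Z')"
    and rk_eq: "\<And>A. A \<subseteq> {1..d} \<Longrightarrow> chain_rk l u Z A = chain_rk l u Z' A"
  shows "Z = Z'"
proof -
  interpret S: strict_box_chain d l u "length (fst Z)" "Xset (fst Z)" "rval (snd Z)" by fact
  interpret T: strict_box_chain d l u "length (fst Z')" "Xset (fst Z')" "rval (snd Z')" by fact
  have set_eq: "set ({} # Xs) = Xset Xs ` {..length Xs}" for Xs
    unfolding Xset_def set_conv_nth by (auto simp: less_Suc_eq_le)
  have "{} # fst Z = {} # fst Z'"
  proof (rule sorted_wrt_psubset_unique)
    show "sorted_wrt (\<subset>) ({} # fst Z)"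
      using S.X_mono unfolding sorted_wrt_iff_nth_less Xset_def by simp
    show "sorted_wrt (\<subset>) ({} # fst Z')"
      using T.X_mono unfolding sorted_wrt_iff_nth_less Xset_def by simp
    show "set ({} # fst Z) = set ({} # fst Z')"
      unfolding set_eq
      using S.X_in_chain_of_rk[OF T.box_chain_axioms _ rk_eq]
        T.X_in_chain_of_rk[OF S.box_chain_axioms _ rk_eq[symmetric]] by blast
  qed
  then have fst_eq: "fst Z = fst Z'" by simp
  moreover have "snd Z = snd Z'"
  proof (rule nth_equalityI)
    show "length (snd Z) = length (snd Z')" using Z(2) Z'(2) fst_eq by simp
    fix i assume "i < length (snd Z)"
    then have i: "Suc i \<le> length (fst Z)" "Suc i \<le> length (fst Z')" using Z(2) fst_eq by auto
    then show "snd Z ! i = snd Z' ! i"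
      using S.rk_X[OF i(1)] T.rk_X[OF i(2)] rk_eq[OF S.X_sub[OF i(1)]] fst_eq
      by (simp add: rval_def)
  qed
  ultimately show ?thesis by (rule prod_eqI)
qed

text \<open>By integrality, \<open>v z x = s x\<close> means reaching the threshold
  \<open>s x\<close> but not \<open>s x + 1\<close>. Subtracting the two sums turns thresholds into
  equations, one member of \<open>J\<close> at a time.\<close>

lemma sum_at_thresholds_zero:
  fixes a :: "'z \<Rightarrow> int" and v :: "'z \<Rightarrow> 'a \<Rightarrow> int"
  assumes "finite J" "finite F"
    and "\<And>s. (\<Sum>z\<in>{z\<in>F. \<forall>A\<in>J. s A \<le> v z A}. a z) = 0"
  shows "(\<Sum>z\<in>{z\<in>F. \<forall>A\<in>J. v z A = s A}. a z) = 0"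
  using assms
proof (induction J arbitrary: F)
  case empty
  then show ?case by simp
next
  case (insert x J)
  define F1 where "F1 = {z\<in>F. v z x = s x}"
  have "(\<Sum>z\<in>{z\<in>F1. \<forall>A\<in>J. t A \<le> v z A}. a z) = 0" for t
  proof -
    define t0 where "t0 = t(x := s x)"
    define t1 where "t1 = t(x := s x + 1)"
    have "{z\<in>F. \<forall>A\<in>insert x J. t0 A \<le> v z A}
        = {z\<in>F1. \<forall>A\<in>J. t A \<le> v z A} \<union> {z\<in>F. \<forall>A\<in>insert x J. t1 A \<le> v z A}"
      using \<open>x \<notin> J\<close> by (auto simp: F1_def t0_def t1_def)
    moreover have "{z\<in>F1. \<forall>A\<in>J. t A \<le> v z A} \<inter> {z\<in>F. \<forall>A\<in>insert x J. t1 A \<le> v z A} = {}"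
      by (auto simp: F1_def t1_def)
    ultimately have "(\<Sum>z\<in>{z\<in>F. \<forall>A\<in>insert x J. t0 A \<le> v z A}. a z)
        = (\<Sum>z\<in>{z\<in>F1. \<forall>A\<in>J. t A \<le> v z A}. a z) + (\<Sum>z\<in>{z\<in>F. \<forall>A\<in>insert x J. t1 A \<le> v z A}. a z)"
      using \<open>finite F\<close> by (simp add: sum.union_disjoint F1_def)
    then show ?thesis using insert.prems(2) by simp
  qed
  then have "(\<Sum>z\<in>{z\<in>F1. \<forall>A\<in>J. v z A = s A}. a z) = 0"
    using \<open>finite F\<close> by (intro insert.IH) (auto simp: F1_def)
  moreover have "{z\<in>F1. \<forall>A\<in>J. v z A = s A} = {z\<in>F. \<forall>A\<in>insert x J. v z A = s A}"
    by (auto simp: F1_def)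
  ultimately show ?case by simp
qed

text \<open>Testing the relation against the polyhedra \<open>{y. s A \<le> y(A) for A in J}\<close> for a chain \<open>J\<close>
  isolates the terms whose rank function takes prescribed values on \<open>J\<close>.\<close>

lemma sum_rk_on_chain_zero:
  assumes "finite F" and chain: "\<And>Z. Z \<in> F \<Longrightarrow> box_chain_list d l u Z"
    and zero: "\<And>y. (\<Sum>Z\<in>F. a Z * indicator (chain_polytope d l u Z) y) = (0::int)"
    and J: "J \<subseteq> Pow {1..d}" "\<And>A B. A \<in> J \<Longrightarrow> B \<in> J \<Longrightarrow> A \<subseteq> B \<or> B \<subseteq> A"
  shows "(\<Sum>Z\<in>{Z\<in>F. \<forall>A\<in>J. chain_rk l u Z A = s A}. a Z) = 0"
proof (rule sum_at_thresholds_zero)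
  show "finite J" using J(1) finite_subset by blast
  show "finite F" by fact
  fix s
  define H where "H = {y::nat \<Rightarrow> real. \<forall>A\<in>J. of_int (s A) \<le> (\<Sum>i\<in>A. y i)}"
  have "H = (\<Inter>A\<in>J. {y. of_int (s A) \<le> (\<Sum>i\<in>A. y i)})" by (auto simp: H_def)
  then have "closed H" by (simp add: closed_INT closed_sum_constraint)
  have "(\<Sum>Z\<in>{Z\<in>F. chain_polytope d l u Z \<inter> H \<noteq> {}}. a Z) = 0"
    using \<open>finite F\<close>
  proof (rule compact_convex_indicators_sum_zero)
    fix Z assume "Z \<in> F"
    then interpret box_chain d l u "length (fst Z)" "Xset (fst Z)" "rval (snd Z)" by (rule chain)
    show "compact (polytope \<inter> H)" using compact_polytope \<open>closed H\<close> by (rule compact_Int_closed)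
    show "seg_closed (polytope \<inter> H)" unfolding H_def by (rule seg_closed_polytope_Int)
    show "polytope \<inter> H \<subseteq> rvec d" by (auto simp: polytope_def)
  next
    fix y
    have "(\<Sum>Z\<in>F. a Z * indicator (chain_polytope d l u Z \<inter> H) y)
        = (\<Sum>Z\<in>F. a Z * indicator (chain_polytope d l u Z) y) * indicator H y"
      by (simp add: sum_distrib_right indicator_inter_arith mult.assoc)
    then show "(\<Sum>Z\<in>F. a Z * indicator (chain_polytope d l u Z \<inter> H) y) = 0" using zero by simp
  qed
  moreover have "chain_polytope d l u Z \<inter> H \<noteq> {} \<longleftrightarrow> (\<forall>A\<in>J. s A \<le> chain_rk l u Z A)" if "Z \<in> F" for Z
    unfolding H_def by (rule box_chain.polytope_meets_iff[OF chain[OF that] J])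
  ultimately show "(\<Sum>Z\<in>{Z\<in>F. \<forall>A\<in>J. s A \<le> chain_rk l u Z A}. a Z) = 0"
    by (simp cong: conj_cong)
qed

text \<open>Take a term \<open>Z0\<close> with nonzero coefficient and inclusion-minimal polytope. A
  term whose rank function agrees with that of \<open>Z0\<close> on the chain of \<open>Z0\<close>
  has its polytope inside that of \<open>Z0\<close>; minimality then forces the same polytope, the
  same rank function and the same index. So isolating these values leaves only \<open>a Z0\<close>,
  which must vanish.\<close>

lemma strict_box_chains_independent:
  assumes "finite F"
    and chain: "\<And>Z. Z \<in> F \<Longrightarrow> strict_box_chain_list d l u Z \<and> length (snd Z) = length (fst Z)"
    and zero: "\<And>y. (\<Sum>Z\<in>F. a Z * indicator (chain_polytope d l u Z) y) = (0::int)"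
    and "Z \<in> F"
  shows "a Z = 0"
proof (rule ccontr)
  assume "a Z \<noteq> 0"
  define G where "G = {Z\<in>F. a Z \<noteq> 0}"
  have finG: "finite G" and "Z \<in> G" using \<open>finite F\<close> \<open>a Z \<noteq> 0\<close> \<open>Z \<in> F\<close> by (auto simp: G_def)
  have zeroG: "(\<Sum>Z\<in>G. a Z * indicator (chain_polytope d l u Z) y) = 0" for y
  proof -
    have "(\<Sum>Z\<in>G. a Z * indicator (chain_polytope d l u Z) y)
        = (\<Sum>Z\<in>F. a Z * indicator (chain_polytope d l u Z) y)"
      unfolding G_def using \<open>finite F\<close> by (intro sum.mono_neutral_left) auto
    then show ?thesis using zero by simp
  qed
  have strict: "strict_box_chain_list d l u Z" "length (snd Z) = length (fst Z)" if "Z \<in> G" for Z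
    using chain that by (auto simp: G_def)
  have box: "box_chain_list d l u Z" if "Z \<in> G" for Z
    using strict(1)[OF that] by (rule strict_box_chain.axioms)
  have "chain_polytope d l u ` G \<noteq> {}" using \<open>Z \<in> G\<close> by blast
  from finite_has_minimal[OF finite_imageI[OF finG] this]
  obtain Z0 where Z0: "Z0 \<in> G"
    and min: "\<forall>Q\<in>chain_polytope d l u ` G. Q \<subseteq> chain_polytope d l u Z0
      \<longrightarrow> chain_polytope d l u Z0 = Q"
    by blast
  interpret S: strict_box_chain d l u "length (fst Z0)" "Xset (fst Z0)" "rval (snd Z0)"
    by (rule strict(1)[OF Z0])
  define J where "J = Xset (fst Z0) ` {..length (fst Z0)}"
  have J_sub: "J \<subseteq> Pow {1..d}" using S.X_sub by (auto simp: J_def)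
  have J_chain: "A \<subseteq> B \<or> B \<subseteq> A" if AB: "A \<in> J" "B \<in> J" for A B
  proof -
    obtain i j where "i \<le> length (fst Z0)" "A = Xset (fst Z0) i"
      "j \<le> length (fst Z0)" "B = Xset (fst Z0) j"
      using AB by (auto simp: J_def)
    then show ?thesis using S.X_le[of i j] S.X_le[of j i] by (cases "i \<le> j") auto
  qed
  have "Z = Z0" if Z: "Z \<in> G" and eq: "\<And>A. A \<in> J \<Longrightarrow> chain_rk l u Z A = S.rk A" for Z
  proof -
    interpret T: strict_box_chain d l u "length (fst Z)" "Xset (fst Z)" "rval (snd Z)"
      by (rule strict(1)[OF Z])
    have eq': "T.rk (Xset (fst Z0) j) = rval (snd Z0) j" if "j \<le> length (fst Z0)" for j
      using eq[of "Xset (fst Z0) j"] S.rk_X[OF that] that by (auto simp: J_def)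
    have "T.polytope \<subseteq> S.polytope"
    proof
      fix y assume y: "y \<in> T.polytope"
      have "(\<Sum>i\<in>Xset (fst Z0) j. y i) \<le> of_int (rval (snd Z0) j)" if "j \<le> length (fst Z0)" for j
        using T.polytope_sum_le_rk[OF y S.X_sub[OF that]] eq'[OF that] by simp
      moreover have "rval (snd Z) (length (fst Z)) = rval (snd Z0) (length (fst Z0))"
        using eq'[of "length (fst Z0)"] T.rk_ground S.X_k by simp
      ultimately show "y \<in> S.polytope" using y by (simp add: S.polytope_def T.polytope_def)
    qed
    then have poly_eq: "T.polytope = S.polytope" using min Z by blast
    \<comment> \<open>\<open>rk A\<close> is the maximum of \<open>y(A)\<close> over the polytope,
      so it depends on the polytope alone.\<close>
    have "T.rk A = S.rk A" if A: "A \<subseteq> {1..d}" for A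
    proof (rule antisym)
      obtain y where "y \<in> T.polytope" "(\<Sum>i\<in>A. y i) = of_int (T.rk A)"
        using T.polytope_attains[of "{A}"] A by auto
      then have "real_of_int (T.rk A) \<le> of_int (S.rk A)"
        using S.polytope_sum_le_rk[OF _ A, of y] poly_eq by simp
      then show "T.rk A \<le> S.rk A" by simp
      obtain y where "y \<in> S.polytope" "(\<Sum>i\<in>A. y i) = of_int (S.rk A)"
        using S.polytope_attains[of "{A}"] A by auto
      then have "real_of_int (S.rk A) \<le> of_int (T.rk A)"
        using T.polytope_sum_le_rk[OF _ A, of y] poly_eq by simp
      then show "S.rk A \<le> T.rk A" by simp
    qed
    then show ?thesis
      using strict_box_chain_list_eq[OF strict[OF Z] strict[OF Z0]] by blast
  qed
  then have "{Z\<in>G. \<forall>A\<in>J. chain_rk l u Z A = S.rk A} = {Z0}" using Z0 by auto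
  then have "a Z0 = 0"
    using sum_rk_on_chain_zero[OF finG box zeroG J_sub J_chain, of S.rk] by simp
  then show False using Z0 by (simp add: G_def)
qed

subsection \<open>Decomposing base polyhedra into chain regions\<close>

lemma sum_zscale_apply: "(\<Sum>i\<in>I. zscale (c i) (g i)) x = (\<Sum>i\<in>I. c i * g i x)"
  by (induction I rule: infinite_finite_induct) (auto simp: zscale_def)

text \<open>The criterion concerns indexed families, so it also gives injectivity: two indices with
  the same function would satisfy the relation with coefficients \<open>1\<close> and
  \<open>-1\<close>.\<close>

lemma free_abelian_basisI:
  assumes indep: "\<And>F a i. finite F \<Longrightarrow> F \<subseteq> I \<Longrightarrow> (\<And>x. (\<Sum>i\<in>F. a i * b i x) = 0) \<Longrightarrow> i \<in> F \<Longrightarrow> a i = 0"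
    and span: "zmod.span (b ` I) = P"
  shows "free_abelian_basis P I b"
proof -
  have inj: "inj_on b I"
  proof (rule inj_onI, rule ccontr)
    fix i j assume ij: "i \<in> I" "j \<in> I" "b i = b j" "i \<noteq> j"
    define a where "a m = (if m = i then 1 else - 1 :: int)" for m
    have "a i = 0"
      by (rule indep[of "{i, j}"]) (use ij in \<open>auto simp: a_def\<close>)
    then show False by (simp add: a_def)
  qed
  moreover have "zmod.independent (b ` I)"
  proof
    assume "zmod.dependent (b ` I)"
    then obtain t u v where t: "finite t" "t \<subseteq> b ` I" "(\<Sum>v\<in>t. zscale (u v) v) = 0"
      and v: "v \<in> t" "u v \<noteq> 0"
      unfolding zmod.dependent_explicit by blast
    \<comment> \<open>One index is chosen for each vector of the relation, which becomes a relation
      between distinct indices.\<close>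
    obtain F where F: "F \<subseteq> I" "inj_on b F" "t = b ` F"
      using t(2) by (auto simp: subset_image_inj)
    have "finite F" using t(1) F finite_image_iff by blast
    obtain i where i: "i \<in> F" "v = b i" using v(1) F by blast
    have "(u \<circ> b) i = 0"
    proof (rule indep[OF \<open>finite F\<close> F(1) _ i(1)])
      fix x
      have "(\<Sum>i\<in>F. (u \<circ> b) i * b i x) = (\<Sum>v\<in>t. u v * v x)"
        using F by (simp add: sum.reindex)
      also have "\<dots> = 0" using fun_cong[OF t(3), of x] by (simp add: sum_zscale_apply)
      finally show "(\<Sum>i\<in>F. (u \<circ> b) i * b i x) = 0" .
    qed
    then show False using v i by simp
  qed
  ultimately show ?thesis using span by (simp add: free_abelian_basis_def)
qed

lemma eInts_cases:
  assumes "x \<in> eInts"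
  obtains n where "x = ereal (of_int n)"
  using assms by (auto simp: eInts_def)

definition obeys :: "(nat set \<Rightarrow> ereal) \<Rightarrow> (nat \<Rightarrow> real) \<Rightarrow> nat set \<Rightarrow> bool" where
  "obeys rk y A \<longleftrightarrow> ereal (\<Sum>i\<in>A. y i) \<le> rk A"

text \<open>The sets all of whose subsets obey the constraints form a simplicial complex on \<open>B\<close>. If it is
  not the full simplex, submodularity makes it a cone with apex any point of \<open>B\<close> outside
  a set \<open>M\<close> at which \<open>rk(M) - y(M)\<close> is minimal.\<close>

lemma obeying_complex_is_cone:
  assumes mega: "megamatroid d rk" and B: "B \<subseteq> {1..d}" "B \<noteq> {}" and "obeys rk y B"
  obtains b where "b \<in> B"
    "\<And>A. A \<subseteq> B - {b} \<Longrightarrow> \<forall>C\<subseteq>A. obeys rk y C \<Longrightarrow> \<forall>C\<subseteq>insert b A. obeys rk y C"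
proof (cases "\<forall>C\<subseteq>B. obeys rk y C")
  case True
  from B obtain b where "b \<in> B" by blast
  then show ?thesis using that[of b] True by blast
next
  case False
  define V where "V = {C. C \<subseteq> B \<and> \<not> obeys rk y C}"
  \<comment> \<open>\<open>g C\<close> is the slack of the constraint at \<open>C\<close>.
    \<open>real_of_ereal\<close> sends infinity to 0, but \<open>g\<close> is only compared at sets
    of integral rank; violated constraints always have such a rank.\<close>
  define g where "g C = real_of_ereal (rk C) - (\<Sum>i\<in>C. y i)" for C
  have finB: "finite B" using B finite_subset by blast
  have finV: "finite V" "V \<noteq> {}" using False finB by (auto simp: V_def)
  define M where "M = arg_min_on g V"
  have M: "M \<in> V" "\<And>C. C \<in> V \<Longrightarrow> g M \<le> g C"
    unfolding M_def using arg_min_if_finite(1)[OF finV] arg_min_least[OF finV] by blast+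
  have rk_range: "rk C \<in> eInts \<union> {\<infinity>}" if "C \<subseteq> B" for C
    using mega that B unfolding megamatroid_def by blast
  have V_rk: "rk C \<in> eInts" "g C < 0" if "C \<in> V" for C
  proof -
    have C: "C \<subseteq> B" "\<not> ereal (\<Sum>i\<in>C. y i) \<le> rk C" using that by (auto simp: V_def obeys_def)
    then have "rk C \<noteq> \<infinity>" by auto
    then show "rk C \<in> eInts" using rk_range[OF C(1)] by blast
    then show "g C < 0" using C(2) by (auto simp: g_def elim: eInts_cases)
  qed
  \<comment> \<open>\<open>B\<close> itself obeys its constraint, so \<open>M\<close> is a proper
    subset and an apex outside it exists.\<close>
  have "M \<subseteq> B" "M \<noteq> B" using M(1) \<open>obeys rk y B\<close> by (auto simp: V_def)
  then obtain b where b: "b \<in> B" "b \<notin> M" by blast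
  have "\<forall>C\<subseteq>insert b A. obeys rk y C" if A: "A \<subseteq> B - {b}" "\<forall>C\<subseteq>A. obeys rk y C" for A
  proof (intro allI impI, rule ccontr)
    fix C assume C: "C \<subseteq> insert b A" "\<not> obeys rk y C"
    then have "C \<in> V" using A b by (auto simp: V_def)
    have sub: "C \<subseteq> {1..d}" "M \<subseteq> {1..d}" "C \<union> M \<subseteq> B"
      using \<open>C \<in> V\<close> M(1) B by (auto simp: V_def)
    have "rk (C \<union> M) \<in> eInts \<and> rk (C \<inter> M) \<in> eInts \<and> rk (C \<union> M) + rk (C \<inter> M) \<le> rk C + rk M"
      using mega sub V_rk(1)[OF \<open>C \<in> V\<close>] V_rk(1)[OF M(1)] unfolding megamatroid_def by blast
    moreover obtain m n where mn: "rk C = ereal (of_int m)" "rk M = ereal (of_int n)"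
      using V_rk(1)[OF \<open>C \<in> V\<close>] V_rk(1)[OF M(1)] by (metis eInts_cases)
    ultimately obtain p q where pq: "rk (C \<union> M) = ereal (of_int p)" "rk (C \<inter> M) = ereal (of_int q)"
      and le: "p + q \<le> m + n" by (auto elim!: eInts_cases)
    have "finite C" "finite M" using sub finite_subset by blast+
    then have "(\<Sum>i\<in>C \<union> M. y i) + (\<Sum>i\<in>C \<inter> M. y i) = (\<Sum>i\<in>C. y i) + (\<Sum>i\<in>M. y i)"
      by (rule sum.union_inter)
    moreover have "real_of_int p + of_int q \<le> of_int m + of_int n"
      using le by linarith
    ultimately have "g (C \<union> M) + g (C \<inter> M) \<le> g C + g M"
      by (simp add: g_def mn pq)
    \<comment> \<open>As \<open>b \<notin> M\<close>, the intersection lies in \<open>A\<close> and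
      has nonnegative slack. So \<open>C \<union> M\<close> is violated even more than
      \<open>M\<close>, against minimality.\<close>
    moreover have "C \<inter> M \<subseteq> A" using C(1) b by auto
    then have "obeys rk y (C \<inter> M)" using A(2) by blast
    then have "g (C \<inter> M) \<ge> 0" using pq by (simp add: obeys_def g_def)
    ultimately have less: "g (C \<union> M) < g M" using V_rk(2)[OF \<open>C \<in> V\<close>] by linarith
    then have "g (C \<union> M) < 0" using V_rk(2)[OF M(1)] by linarith
    then have "\<not> obeys rk y (C \<union> M)" using pq by (simp add: g_def obeys_def)
    then have "C \<union> M \<in> V" using sub by (simp add: V_def)
    then show False using M(2)[of "C \<union> M"] less by simp
  qed
  then show ?thesis using that[OF b(1)] by blast
qed

text \<open>Inserting or removing the apex \<open>b\<close> pairs the faces of the complex with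
  opposite signs.\<close>

lemma alternating_sum_obeying_complex:
  assumes "megamatroid d rk" "B \<subseteq> {1..d}" "B \<noteq> {}" "obeys rk y B"
  shows "(\<Sum>A\<in>Pow B. (- 1) ^ card A * of_bool (\<forall>C\<subseteq>A. obeys rk y C)) = (0::int)"
proof -
  obtain b where b: "b \<in> B"
    "\<And>A. A \<subseteq> B - {b} \<Longrightarrow> \<forall>C\<subseteq>A. obeys rk y C \<Longrightarrow> \<forall>C\<subseteq>insert b A. obeys rk y C"
    using obeying_complex_is_cone[OF assms] by blast
  define h where "h A = (- 1) ^ card A * (of_bool (\<forall>C\<subseteq>A. obeys rk y C) :: int)" for A
  define D where "D = B - {b}"
  have finD: "finite D" and B: "B = insert b D" "b \<notin> D"
    using assms(2) b(1) finite_subset by (auto simp: D_def)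
  have "h (insert b A) = - h A" if A: "A \<in> Pow D" for A
  proof -
    have "finite A" "b \<notin> A" using A finD B(2) finite_subset by auto
    moreover have "(\<forall>C\<subseteq>insert b A. obeys rk y C) \<longleftrightarrow> (\<forall>C\<subseteq>A. obeys rk y C)"
      using b(2)[of A] A by (auto simp: D_def)
    ultimately show ?thesis by (simp add: h_def)
  qed
  moreover have "inj_on (insert b) (Pow D)" using B(2) by (auto simp: inj_on_def)
  ultimately have "(\<Sum>A\<in>insert b ` Pow D. h A) = - (\<Sum>A\<in>Pow D. h A)"
    by (simp add: sum.reindex sum_negf)
  moreover have "Pow B = Pow D \<union> insert b ` Pow D" unfolding B(1) by (rule Pow_insert)
  moreover have "Pow D \<inter> insert b ` Pow D = {}" using B(2) by auto
  ultimately have "(\<Sum>A\<in>Pow B. h A) = 0" using finD by (simp add: sum.union_disjoint)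
  then show ?thesis by (simp add: h_def)
qed

lemma span_mult_indicator:
  assumes "f \<in> zmod.span S" and "\<And>g. g \<in> S \<Longrightarrow> (\<lambda>x. g x * indicator U x) \<in> zmod.span S'"
  shows "(\<lambda>x. f x * indicator U x) \<in> zmod.span S'"
proof (rule zmod.span_induct[OF assms(1)])
  show "zmod.subspace {f. (\<lambda>x. f x * indicator U x) \<in> zmod.span S'}"
  proof (rule zmod.subspaceI)
    show "0 \<in> {f. (\<lambda>x. f x * indicator U x) \<in> zmod.span S'}"
      using zmod.span_zero[of S'] by (simp add: zero_fun_def)
    fix f g :: "'a \<Rightarrow> int" and c :: int
    assume f: "f \<in> {f. (\<lambda>x. f x * indicator U x) \<in> zmod.span S'}"
    have "(\<lambda>x. zscale c f x * indicator U x) = zscale c (\<lambda>x. f x * indicator U x)"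
      by (auto simp: zscale_def)
    then show "zscale c f \<in> {f. (\<lambda>x. f x * indicator U x) \<in> zmod.span S'}"
      using f zmod.span_scale by auto
    assume g: "g \<in> {f. (\<lambda>x. f x * indicator U x) \<in> zmod.span S'}"
    have "(\<lambda>x. (f + g) x * indicator U x) = (\<lambda>x. f x * indicator U x) + (\<lambda>x. g x * indicator U x)"
      by (auto simp: algebra_simps)
    then show "f + g \<in> {f. (\<lambda>x. f x * indicator U x) \<in> zmod.span S'}"
      using f g zmod.span_add by auto
  qed
qed (use assms(2) in auto)

definition chain_regions :: "(nat set \<Rightarrow> ereal) \<Rightarrow> (nat \<Rightarrow> real) set \<Rightarrow> nat set \<Rightarrow> ((nat \<Rightarrow> real) \<Rightarrow> int) set"
  where "chain_regions rk T B = {indicator {y\<in>T. \<forall>A\<in>\<C>. obeys rk y A} | \<C>.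
     \<C> \<subseteq> Pow B \<and> (\<forall>A\<in>\<C>. \<forall>A'\<in>\<C>. A \<subseteq> A' \<or> A' \<subseteq> A)}"

text \<open>Where \<open>B\<close> obeys its constraint, the vanishing alternating sum expresses the
  indicator for \<open>B\<close> through those for its proper subsets. Restricting to
  \<open>U\<close> adds \<open>B\<close> on top of each chain obtained by induction.\<close>

lemma indicator_obeying_in_span_chain_regions:
  assumes mega: "megamatroid d rk" and "B \<subseteq> {1..d}"
  shows "indicator {y\<in>T. \<forall>C\<subseteq>B. obeys rk y C} \<in> zmod.span (chain_regions rk T B)"
proof -
  have "finite B" using assms(2) finite_subset by blast
  then show ?thesis using assms(2)
  proof (induction B rule: finite_psubset_induct)
    case (psubset B)
    show ?case
    proof (cases "B = {}")
      case True
      have "indicator {y\<in>T. \<forall>C\<subseteq>B. obeys rk y C} \<in> chain_regions rk T B"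
        unfolding chain_regions_def True by (intro CollectI exI[of _ "{{}}"]) auto
      then show ?thesis by (rule zmod.span_base)
    next
      case False
      define \<Phi> :: "nat set \<Rightarrow> (nat \<Rightarrow> real) \<Rightarrow> int"
        where "\<Phi> A = indicator {y\<in>T. \<forall>C\<subseteq>A. obeys rk y C}" for A
      define U where "U = {y. obeys rk y B}"
      have "\<Phi> B y = (\<Sum>A\<in>Pow B - {B}. - ((- 1) ^ (card A + card B)) * (\<Phi> A y * indicator U y))" for y
      proof (cases "y \<in> T \<and> y \<in> U")
        case True
        define h where "h A = (- 1) ^ card A * \<Phi> A y" for A
        have "\<Phi> A y = of_bool (\<forall>C\<subseteq>A. obeys rk y C)" for A
          using True by (simp add: \<Phi>_def indicator_def)
        then have "(\<Sum>A\<in>Pow B. h A) = 0"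
          using alternating_sum_obeying_complex[OF mega psubset.prems False] True
          by (simp add: U_def h_def)
        moreover have "(\<Sum>A\<in>Pow B. h A) = h B + (\<Sum>A\<in>Pow B - {B}. h A)"
          using psubset.hyps by (intro sum.remove) auto
        ultimately have "h B = - (\<Sum>A\<in>Pow B - {B}. h A)" by linarith
        \<comment> \<open>Multiplying by the sign of \<open>B\<close> once more isolates
          \<open>\<Phi> B y\<close>, the square of the sign being 1.\<close>
        then have "(- 1) ^ card B * h B = (\<Sum>A\<in>Pow B - {B}. - ((- 1) ^ card B * h A))"
          by (simp add: sum_negf sum_distrib_left)
        moreover have "(- 1) ^ card B * h B = \<Phi> B y"
          by (simp add: h_def flip: mult.assoc power_add mult_2)
        ultimately show ?thesis using True by (simp add: h_def power_add mult.commute mult.left_commute)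
      next
        case False
        then have "\<Phi> B y = 0" and *: "\<Phi> A y * indicator U y = 0" for A
          by (auto simp: \<Phi>_def U_def indicator_def)
        then show ?thesis unfolding * by simp
      qed
      then have "\<Phi> B = (\<Sum>A\<in>Pow B - {B}. zscale (- ((- 1) ^ (card A + card B))) (\<lambda>y. \<Phi> A y * indicator U y))"
        by (intro ext) (simp only: sum_zscale_apply)
      moreover have "(\<lambda>y. \<Phi> A y * indicator U y) \<in> zmod.span (chain_regions rk T B)"
        if A: "A \<in> Pow B - {B}" for A
      proof (rule span_mult_indicator)
        show "\<Phi> A \<in> zmod.span (chain_regions rk T A)"
          unfolding \<Phi>_def using A psubset.prems by (intro psubset.IH) auto
        fix g assume "g \<in> chain_regions rk T A"
        then obtain \<C> where \<C>: "\<C> \<subseteq> Pow A" "\<forall>A\<in>\<C>. \<forall>A'\<in>\<C>. A \<subseteq> A' \<or> A' \<subseteq> A"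
          and g: "g = indicator {y\<in>T. \<forall>A\<in>\<C>. obeys rk y A}" by (auto simp: chain_regions_def)
        have "(\<lambda>y. g y * indicator U y) = indicator {y\<in>T. \<forall>A\<in>insert B \<C>. obeys rk y A}"
          by (auto simp: g U_def indicator_def fun_eq_iff)
        moreover have sub: "insert B \<C> \<subseteq> Pow B" using \<C>(1) A by blast
        moreover have "\<forall>A\<in>insert B \<C>. \<forall>A'\<in>insert B \<C>. A \<subseteq> A' \<or> A' \<subseteq> A"
          using \<C>(2) sub by blast
        ultimately have "(\<lambda>y. g y * indicator U y) \<in> chain_regions rk T B"
          unfolding chain_regions_def by blast
        then show "(\<lambda>y. g y * indicator U y) \<in> zmod.span (chain_regions rk T B)"
          by (rule zmod.span_base)
      qed
      ultimately have "\<Phi> B \<in> zmod.span (chain_regions rk T B)"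
        by (simp only:) (intro zmod.span_sum zmod.span_scale)
      then show ?thesis by (simp add: \<Phi>_def)
    qed
  qed
qed

subsection \<open>The index sets of the bases\<close>

text \<open>The part of \<open>R_poly\<close> that does not involve the chain, separated so that the
  spanning argument treats the three kinds uniformly.\<close>

fun ambient :: "kind \<Rightarrow> nat \<Rightarrow> int \<Rightarrow> (nat \<Rightarrow> real) set" where
  "ambient MM d r = {y \<in> rvec d. (\<Sum>i\<in>{1..d}. y i) = of_int r}"
| "ambient PM d r = simplex_PM d r"
| "ambient Mat d r = simplex_M d r"

lemma ambientD:
  assumes "y \<in> ambient \<kappa> d r"
  shows "y \<in> rvec d" "(\<Sum>i\<in>{1..d}. y i) = of_int r"
  using assms by (cases \<kappa>; auto simp: simplex_PM_def simplex_M_def)+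

lemma R_poly_eq:
  assumes "rval rs (length rs) = r"
  shows "R_poly \<kappa> d (Xs, rs)
    = {y \<in> ambient \<kappa> d r. \<forall>j\<in>{1..length Xs}. (\<Sum>i\<in>Xset Xs j. y i) \<le> of_int (rval rs j)}"
  using assms by (cases \<kappa>) (auto simp: R_MM_def simplex_PM_def simplex_M_def)

lemma Xset_0 [simp]: "Xset Xs 0 = {}" and rval_0 [simp]: "rval rs 0 = 0"
  by (auto simp: Xset_def rval_def)

lemma increasing_from_steps:
  fixes g :: "nat \<Rightarrow> 'a::order"
  assumes "\<And>j. m \<le> j \<Longrightarrow> j < n \<Longrightarrow> g j < g (Suc j)" and "m \<le> i" "i < j" "j \<le> n"
  shows "g i < g j"
  using assms(3,4)
proof (induction j)
  case (Suc j)
  then show ?case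
    using assms(1)[of j] assms(2) by (cases "i = j") (auto intro: order.strict_trans)
qed simp

lemma is_chain_mono:
  assumes "is_chain d Xs" "i < j" "j \<le> length Xs"
  shows "Xset Xs i \<subset> Xset Xs j"
  by (rule increasing_from_steps[of 0 "length Xs"]) (use assms in \<open>auto simp: is_chain_def\<close>)

lemma card_Xset_Diff:
  assumes "is_chain d Xs" "i < j" "j \<le> length Xs"
  shows "int (card (Xset Xs j - Xset Xs i)) = int (card (Xset Xs j)) - int (card (Xset Xs i))"
    "0 < card (Xset Xs j - Xset Xs i)"
proof -
  have "Xset Xs j \<subseteq> {1..d}"
    using is_chain_mono[OF assms(1), of j "length Xs"] assms
    by (cases "j = length Xs") (auto simp: is_chain_def)
  then have fin: "finite (Xset Xs j)" using finite_subset by blast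
  have sub: "Xset Xs i \<subset> Xset Xs j" by (rule is_chain_mono[OF assms])
  then have "finite (Xset Xs i)" using fin finite_subset by blast
  then show "int (card (Xset Xs j - Xset Xs i)) = int (card (Xset Xs j)) - int (card (Xset Xs i))"
    using sub fin by (auto simp: card_Diff_subset card_mono of_nat_diff)
  show "0 < card (Xset Xs j - Xset Xs i)" using sub fin by (auto simp: card_gt_0_iff)
qed

lemma strict_box_chain_listI:
  assumes "l < u" "is_chain d (fst Z)"
    and "\<And>i j. i < j \<Longrightarrow> j \<le> length (fst Z) \<Longrightarrow>
      l * int (card (Xset (fst Z) j - Xset (fst Z) i)) \<le> rval (snd Z) j - rval (snd Z) i"
    and "\<And>i j. i < j \<Longrightarrow> j \<le> length (fst Z) \<Longrightarrow>
      rval (snd Z) j - rval (snd Z) i \<le> u * int (card (Xset (fst Z) j - Xset (fst Z) i))"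
    and "\<And>i j. 1 \<le> i \<Longrightarrow> i < j \<Longrightarrow> j \<le> length (fst Z) \<Longrightarrow>
      l * int (card (Xset (fst Z) j - Xset (fst Z) i)) < rval (snd Z) j - rval (snd Z) i"
    and "\<And>i j. i < j \<Longrightarrow> j < length (fst Z) \<Longrightarrow>
      rval (snd Z) j - rval (snd Z) i < u * int (card (Xset (fst Z) j - Xset (fst Z) i))"
  shows "strict_box_chain_list d l u Z"
  using assms is_chain_mono[OF assms(2)] by unfold_locales (auto simp: is_chain_def)

section \<open>The inequalities of the index sets as box conditions\<close>

lemma p_PM_rval:
  assumes Z: "Z \<in> p_PM d r"
  shows "1 \<le> i \<Longrightarrow> i < j \<Longrightarrow> j \<le> length (fst Z) \<Longrightarrow> rval (snd Z) i < rval (snd Z) j"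
    and "i \<le> j \<Longrightarrow> j \<le> length (fst Z) \<Longrightarrow> rval (snd Z) i \<le> rval (snd Z) j"
    and "j \<le> length (fst Z) \<Longrightarrow> rval (snd Z) j \<le> r" "rval (snd Z) (length (fst Z)) = r"
proof -
  obtain Xs rs where Z_eq: "Z = (Xs, rs)" by (cases Z)
  have Z': "length rs = length Xs" "rval rs (length rs) = r" "1 \<le> length rs \<Longrightarrow> 0 \<le> rval rs 1"
    "\<And>j. 1 \<le> j \<Longrightarrow> j < length rs \<Longrightarrow> rval rs j < rval rs (Suc j)"
    using Z by (auto simp: Z_eq p_PM_def p_MM_def)
  show strict: "rval (snd Z) i < rval (snd Z) j" if "1 \<le> i" "i < j" "j \<le> length (fst Z)" for i j
    by (rule increasing_from_steps[of 1 "length rs"]) (use Z' that in \<open>auto simp: Z_eq\<close>)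
  show weak: "rval (snd Z) i \<le> rval (snd Z) j" if ij: "i \<le> j" "j \<le> length (fst Z)" for i j
  proof -
    \<comment> \<open>The step from index 0 to index 1 may be an equality, so strictness starts at 1
      and index 0 gets its own cases.\<close>
    consider "i = j" | "1 \<le> i" "i < j" | "i = 0" "j = 1" | "i = 0" "1 < j" using ij by linarith
    then show ?thesis
      using strict[of i j] strict[of 1 j] ij Z' by cases (auto simp: Z_eq)
  qed
  show last: "rval (snd Z) (length (fst Z)) = r" using Z' by (simp add: Z_eq)
  show "rval (snd Z) j \<le> r" if "j \<le> length (fst Z)" using weak[OF that order_refl] last by simp
qed

text \<open>All \<open>r_j\<close> lie between 0 and \<open>r\<close>, so the side
  \<open>\<bar>r\<bar> + 1\<close> exceeds every increment and all upper inequalities are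
  strict.\<close>

lemma p_PM_strict_box_chain:
  assumes Z: "Z \<in> p_PM d r"
  shows "strict_box_chain_list d 0 (\<bar>r\<bar> + 1) Z"
proof -
  have chain: "is_chain d (fst Z)" using Z by (auto simp: p_PM_def p_MM_def)
  have less: "rval (snd Z) j - rval (snd Z) i
      < (\<bar>r\<bar> + 1) * int (card (Xset (fst Z) j - Xset (fst Z) i))"
    if ij: "i < j" "j \<le> length (fst Z)" for i j
  proof -
    have "rval (snd Z) 0 \<le> rval (snd Z) i" using p_PM_rval(2)[OF Z, of 0 i] ij by simp
    then have "rval (snd Z) j - rval (snd Z) i < \<bar>r\<bar> + 1"
      using p_PM_rval(3)[OF Z ij(2)] by simp
    also have "\<dots> \<le> (\<bar>r\<bar> + 1) * int (card (Xset (fst Z) j - Xset (fst Z) i))"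
      using mult_left_mono[of 1 "int (card (Xset (fst Z) j - Xset (fst Z) i))" "\<bar>r\<bar> + 1"]
        card_Xset_Diff(2)[OF chain ij] by simp
    finally show ?thesis .
  qed
  show ?thesis
    using less p_PM_rval(1,2)[OF Z] less_imp_le[OF less]
    by (intro strict_box_chain_listI chain) auto
qed

text \<open>For \<open>l = 0\<close> and \<open>u = 1\<close> the lower inequalities are the growth
  of \<open>r_j\<close> and the upper ones the growth of \<open>c j\<close>, which is strict except
  possibly at the last index.\<close>

lemma p_M_strict_box_chain:
  assumes Z: "Z \<in> p_M d r"
  shows "strict_box_chain_list d 0 1 Z"
proof -
  have PM: "Z \<in> p_PM d r" and chain: "is_chain d (fst Z)"
    using Z by (auto simp: p_M_def p_PM_def p_MM_def)
  define c where "c j = int (card (Xset (fst Z) j)) - rval (snd Z) j" for j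
  have c_Suc: "c j < c (Suc j)" if "Suc j < length (fst Z)" for j
    using Z that unfolding p_M_def c_def by (auto simp: Let_def)
  have c_last: "c (length (fst Z) - 1) \<le> c (length (fst Z))" if "1 \<le> length (fst Z)"
    using Z that unfolding p_M_def c_def by (auto simp: Let_def)
  have strict: "c i < c j" if "i < j" "j < length (fst Z)" for i j
    by (rule increasing_from_steps[of 0 "length (fst Z) - 1"]) (use c_Suc that in auto)
  have weak: "c i \<le> c j" if "i < j" "j \<le> length (fst Z)" for i j
  proof (cases "j < length (fst Z)")
    case True then show ?thesis using strict[OF that(1)] by simp
  next
    case False
    then have j: "j = length (fst Z)" "1 \<le> length (fst Z)" using that by auto
    then have "i = length (fst Z) - 1 \<or> i < length (fst Z) - 1" using that by linarith
    then show ?thesis using c_last j strict[of i "length (fst Z) - 1"] by fastforce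
  qed
  have card: "int (card (Xset (fst Z) j - Xset (fst Z) i))
      = (c j - c i) + (rval (snd Z) j - rval (snd Z) i)" if "i < j" "j \<le> length (fst Z)" for i j
    using card_Xset_Diff(1)[OF chain that] by (simp add: c_def)
  show ?thesis
    using p_PM_rval(1,2)[OF PM] strict weak
    by (intro strict_box_chain_listI chain) (auto simp: card)
qed

text \<open>The vectors are unbounded in general, so the box is chosen to exceed all increments that
  occur in the finite family \<open>F\<close>.\<close>

lemma p_MM_strict_box_chains:
  assumes "finite F" "F \<subseteq> p_MM d r"
  obtains N where "\<And>Z. Z \<in> F \<Longrightarrow> strict_box_chain_list d (- N) N Z"
proof -
  define V where "V = (\<Union>Z\<in>F. \<Union>i\<in>{..length (fst Z)}. \<Union>j\<in>{..length (fst Z)}. {\<bar>rval (snd Z) j - rval (snd Z) i\<bar>})"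
  have "finite V" using assms(1) by (auto simp: V_def)
  \<comment> \<open>The inserted 0 gives \<open>N > 0\<close>, also for empty
    \<open>F\<close>.\<close>
  define N where "N = Max (insert 0 V) + 1"
  have V_N: "v < N" if "v \<in> insert 0 V" for v
    using Max_ge[of "insert 0 V" v] \<open>finite V\<close> that unfolding N_def by simp
  have "strict_box_chain_list d (- N) N Z" if Z: "Z \<in> F" for Z
  proof -
    have chain: "is_chain d (fst Z)" using assms(2) Z by (auto simp: p_MM_def)
    have less: "\<bar>rval (snd Z) j - rval (snd Z) i\<bar> < N * int (card (Xset (fst Z) j - Xset (fst Z) i))"
      if ij: "i < j" "j \<le> length (fst Z)" for i j
    proof -
      have "\<bar>rval (snd Z) j - rval (snd Z) i\<bar> \<in> V"
        unfolding V_def by (rule UN_I[OF Z], rule UN_I[of i], use ij in simp, rule UN_I[of j])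
          (use ij in auto)
      then have "\<bar>rval (snd Z) j - rval (snd Z) i\<bar> < N" by (intro V_N) simp
      also have "N \<le> N * int (card (Xset (fst Z) j - Xset (fst Z) i))"
        using mult_left_mono[of 1 "int (card (Xset (fst Z) j - Xset (fst Z) i))" N]
          card_Xset_Diff(2)[OF chain ij] V_N[of 0] by simp
      finally show ?thesis .
    qed
    show ?thesis
    proof (rule strict_box_chain_listI[OF _ chain])
      show "- N < N" using V_N[of 0] by simp
    qed (use less in \<open>fastforce simp: abs_less_iff\<close>)+
  qed
  then show ?thesis using that by blast
qed

section \<open>Chain polyhedra compared with polytopes in a box\<close>

lemma p_set_subset_p_MM: "p_set \<kappa> d r \<subseteq> p_MM d r"
  by (cases \<kappa>) (auto simp: p_PM_def p_M_def)

lemma chain_polytope_iff: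
  assumes "Z \<in> p_MM d r" "box_chain_list d l u Z"
  shows "y \<in> chain_polytope d l u Z \<longleftrightarrow> y \<in> R_poly MM d Z \<and>
    (\<forall>i\<in>{1..d}. of_int l \<le> y i \<and> y i \<le> of_int u)"
proof -
  interpret box_chain d l u "length (fst Z)" "Xset (fst Z)" "rval (snd Z)" by fact
  have *: "(\<forall>j\<le>length (fst Z). (\<Sum>i\<in>Xset (fst Z) j. y i) \<le> of_int (rval (snd Z) j)) \<longleftrightarrow>
      (\<forall>j\<in>{1..length (fst Z)}. (\<Sum>i\<in>Xset (fst Z) j. y i) \<le> of_int (rval (snd Z) j))"
  proof
    assume *: "\<forall>j\<in>{1..length (fst Z)}. (\<Sum>i\<in>Xset (fst Z) j. y i) \<le> of_int (rval (snd Z) j)"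
    show "\<forall>j\<le>length (fst Z). (\<Sum>i\<in>Xset (fst Z) j. y i) \<le> of_int (rval (snd Z) j)"
    proof (intro allI impI)
      fix j assume "j \<le> length (fst Z)"
      then show "(\<Sum>i\<in>Xset (fst Z) j. y i) \<le> of_int (rval (snd Z) j)"
        using * by (cases "j = 0") auto
    qed
  qed auto
  have "y \<in> R_poly MM d Z \<longleftrightarrow> y \<in> rvec d \<and>
      (\<Sum>i\<in>{1..d}. y i) = of_int (rval (snd Z) (length (fst Z))) \<and>
      (\<forall>j\<in>{1..length (fst Z)}. (\<Sum>i\<in>Xset (fst Z) j. y i) \<le> of_int (rval (snd Z) j))"
    using assms(1) by (cases Z) (auto simp: R_MM_def p_MM_def)
  then show ?thesis unfolding polytope_def mem_Collect_eq * by blast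
qed

lemma PM_chain_polytope:
  assumes "Z \<in> p_PM d r"
  shows "chain_polytope d 0 (\<bar>r\<bar> + 1) Z = R_poly PM d Z"
proof (rule set_eqI)
  fix y
  have MM: "Z \<in> p_MM d r" using assms p_set_subset_p_MM[of PM] by auto
  \<comment> \<open>A nonnegative coordinate is at most the total \<open>r\<close>, so the box cuts
    nothing off.\<close>
  have "y i \<le> of_int (\<bar>r\<bar> + 1)" if "y \<in> simplex_PM d r" "i \<in> {1..d}" for i
  proof -
    have "y i \<le> (\<Sum>i\<in>{1..d}. y i)"
      using that by (intro member_le_sum) (auto simp: simplex_PM_def)
    also have "\<dots> = of_int r" using that by (simp add: simplex_PM_def)
    also have "\<dots> \<le> of_int (\<bar>r\<bar> + 1)" by linarith
    finally show ?thesis .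
  qed
  then show "y \<in> chain_polytope d 0 (\<bar>r\<bar> + 1) Z \<longleftrightarrow> y \<in> R_poly PM d Z"
    unfolding chain_polytope_iff[OF MM strict_box_chain.axioms(1)[OF p_PM_strict_box_chain[OF assms]]]
    using MM by (cases Z) (fastforce simp: simplex_PM_def R_MM_def p_MM_def)
qed

lemma M_chain_polytope:
  assumes "Z \<in> p_M d r"
  shows "chain_polytope d 0 1 Z = R_poly Mat d Z"
proof (rule set_eqI)
  fix y
  have MM: "Z \<in> p_MM d r" using assms p_set_subset_p_MM[of Mat] by auto
  show "y \<in> chain_polytope d 0 1 Z \<longleftrightarrow> y \<in> R_poly Mat d Z"
    unfolding chain_polytope_iff[OF MM strict_box_chain.axioms(1)[OF p_M_strict_box_chain[OF assms]]]
    using MM by (cases Z) (auto simp: simplex_M_def R_MM_def p_MM_def)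
qed

text \<open>Megamatroids get a genuine truncation, with \<open>U\<close> the box; for the two
  bounded kinds \<open>U\<close> is everything.\<close>

lemma p_set_strict_box_chains:
  assumes "finite F" "F \<subseteq> p_set \<kappa> d r"
  obtains l u U where "\<And>Z. Z \<in> F \<Longrightarrow> strict_box_chain_list d l u Z"
    "\<And>Z. Z \<in> F \<Longrightarrow> chain_polytope d l u Z = R_poly \<kappa> d Z \<inter> U"
proof (cases \<kappa>)
  case MM
  then have F: "F \<subseteq> p_MM d r" using assms by simp
  obtain N where N: "\<And>Z. Z \<in> F \<Longrightarrow> strict_box_chain_list d (- N) N Z"
    using p_MM_strict_box_chains[OF assms(1) F] by blast
  show ?thesis
  proof (rule that[OF N])
    fix Z assume Z: "Z \<in> F"
    then have "Z \<in> p_MM d r" using F by blast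
    then show "chain_polytope d (- N) N Z = R_poly \<kappa> d Z \<inter>
        {y. \<forall>i\<in>{1..d}. of_int (- N) \<le> y i \<and> y i \<le> of_int N}"
      using chain_polytope_iff[OF _ strict_box_chain.axioms(1)[OF N[OF Z]]] MM by blast
  qed
next
  case PM
  then show ?thesis
    using assms(2) p_PM_strict_box_chain PM_chain_polytope
    by (intro that[of 0 "\<bar>r\<bar> + 1" UNIV]) (auto simp del: split_paired_All)
next
  case Mat
  then show ?thesis
    using assms(2) p_M_strict_box_chain M_chain_polytope
    by (intro that[of 0 1 UNIV]) (auto simp del: split_paired_All)
qed

text \<open>Multiplying the relation by the indicator of \<open>U\<close> carries it over to the
  polytopes in the box.\<close>

lemma R_poly_indicators_independent:
  assumes "finite F" "F \<subseteq> p_set \<kappa> d r"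
    and zero: "\<And>y. (\<Sum>Z\<in>F. a Z * indicator (R_poly \<kappa> d Z) y) = (0::int)" and "Z \<in> F"
  shows "a Z = 0"
proof -
  obtain l u U where F: "\<And>Z. Z \<in> F \<Longrightarrow> strict_box_chain_list d l u Z"
    and eq: "\<And>Z. Z \<in> F \<Longrightarrow> chain_polytope d l u Z = R_poly \<kappa> d Z \<inter> U"
    using p_set_strict_box_chains[OF assms(1,2)] by blast
  show ?thesis
  proof (rule strict_box_chains_independent[OF assms(1) _ _ assms(4)])
    show "strict_box_chain_list d l u Z \<and> length (snd Z) = length (fst Z)" if "Z \<in> F" for Z
      using F[OF that] that assms(2) p_set_subset_p_MM[of \<kappa> d r] by (auto simp: p_MM_def)
    fix y
    have "(\<Sum>Z\<in>F. a Z * indicator (chain_polytope d l u Z) y)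
        = (\<Sum>Z\<in>F. a Z * indicator (R_poly \<kappa> d Z \<inter> U) y)"
      using eq by (intro sum.cong) auto
    also have "\<dots> = (\<Sum>Z\<in>F. a Z * indicator (R_poly \<kappa> d Z) y) * indicator U y"
      by (simp add: sum_distrib_right indicator_inter_arith mult.assoc)
    finally show "(\<Sum>Z\<in>F. a Z * indicator (chain_polytope d l u Z) y) = 0" using zero by simp
  qed
qed

subsection \<open>The chain polyhedra are base polyhedra\<close>

lemma of_int_in_eInts [simp]: "ereal (of_int n) \<in> eInts"
  by (auto simp: eInts_def)

context box_chain
begin

lemma megamatroid_rk: "megamatroid d (\<lambda>A. ereal (of_int (rk A)))"
  unfolding megamatroid_def
proof (intro conjI allI impI)
  fix A B assume "A \<subseteq> {1..d}" "B \<subseteq> {1..d}"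
  then have "rk (A \<union> B) + rk (A \<inter> B) \<le> rk A + rk B"
    using finite_subset by (intro rk_submodular) auto
  then have "real_of_int (rk (A \<union> B) + rk (A \<inter> B)) \<le> of_int (rk A + rk B)" by (simp only: of_int_le_iff)
  then show "ereal (of_int (rk (A \<union> B))) + ereal (of_int (rk (A \<inter> B)))
      \<le> ereal (of_int (rk A)) + ereal (of_int (rk B))" by simp
qed (auto simp: rk_empty)

lemma base_polyhedron_rk: "base_polyhedron d (\<lambda>A. ereal (of_int (rk A))) = polytope"
  unfolding base_polyhedron_def polytope_eq_base by simp

lemma rk_mono:
  assumes "l = 0" "A \<subseteq> B" "finite B"
  shows "rk A \<le> rk B"
proof -
  obtain j where j: "j \<le> k" "rk B = bound j B" by (rule rk_attained)
  have "card (A - X j) \<le> card (B - X j)" using assms by (intro card_mono) auto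
  then have "bound j A \<le> bound j B" using assms(1) l_less_u unfolding bound_def by (simp add: mult_left_mono)
  then show ?thesis using rk_le_bound[OF j(1), of A] j(2) by simp
qed

lemma polymatroid_rk:
  assumes "l = 0"
  shows "polymatroid d (\<lambda>A. ereal (of_int (rk A)))"
  unfolding polymatroid_def
proof (intro conjI allI impI megamatroid_rk)
  fix A assume "A \<subseteq> {1..d}"
  then have "0 \<le> rk A" using rk_mono[OF assms, of "{}" A] rk_empty finite_subset by auto
  then have "ereal (of_int (rk A)) = ereal (of_nat (nat (rk A)))" by simp
  then show "ereal (of_int (rk A)) \<in> range (\<lambda>n::nat. ereal (of_nat n))" by blast
next
  fix A B assume "A \<subseteq> B \<and> B \<subseteq> {1..d}"
  then show "ereal (of_int (rk A)) \<le> ereal (of_int (rk B))"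
    using rk_mono[OF assms, of A B] finite_subset by auto
qed

lemma matroid_rk:
  assumes "l = 0" "u = 1"
  shows "matroid d (\<lambda>A. ereal (of_int (rk A)))"
  unfolding matroid_def
proof (intro conjI ballI polymatroid_rk assms)
  fix i
  have "rk {i} \<le> 1" using rk_le_bound[of 0 "{i}"] assms
    unfolding bound_def by (simp add: X_0 \<rho>_0)
  then show "ereal (of_int (rk {i})) \<le> 1" by (simp add: one_ereal_def)
qed

end

text \<open>The rank function is \<open>r_j\<close> on the chain and infinite elsewhere. Union and
  intersection of two members of a chain are these members again, so submodularity holds with
  equality.\<close>

lemma R_MM_is_base_polyhedron:
  assumes Z: "Z \<in> p_MM d r"
  obtains rk where "megamatroid d rk" "rk {1..d} = ereal (of_int r)" "R_poly MM d Z = base_polyhedron d rk"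
proof -
  obtain Xs rs where Z_eq: "Z = (Xs, rs)" by (cases Z)
  define k where "k = length Xs"
  define X where "X = Xset Xs"
  have chain: "is_chain d Xs" and rs: "length rs = k" "rval rs k = r"
    using Z by (auto simp: Z_eq p_MM_def k_def)
  have X_k: "X k = {1..d}" and X_0: "X 0 = {}" using chain by (auto simp: is_chain_def X_def k_def)
  have X_mono: "X i \<subset> X j" if "i < j" "j \<le> k" for i j
    using is_chain_mono[OF chain] that by (auto simp: X_def k_def)
  have X_le: "X i \<subseteq> X j" if "i \<le> j" "j \<le> k" for i j using X_mono[of i j] that by (cases "i = j") auto
  have inj: "inj_on X {..k}"
  proof (rule linorder_inj_onI)
    show "X i \<noteq> X j" if "i < j" "i \<in> {..k}" "j \<in> {..k}" for i j
      using X_mono[of i j] that by auto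
  qed auto
  define rk where
    "rk A = (if A \<in> X ` {..k} then ereal (of_int (rval rs (the_inv_into {..k} X A))) else \<infinity>)" for A
  have rk_X: "rk (X j) = ereal (of_int (rval rs j))" if "j \<le> k" for j
    using that by (simp add: rk_def the_inv_into_f_f[OF inj])
  have rk_eInts: "rk A \<in> eInts \<longleftrightarrow> A \<in> X ` {..k}" for A
    by (auto simp: rk_def eInts_def)
  have X_chain: "A \<subseteq> B \<or> B \<subseteq> A" if "A \<in> X ` {..k}" "B \<in> X ` {..k}" for A B
  proof -
    obtain i j where "i \<le> k" "A = X i" "j \<le> k" "B = X j" using \<open>A \<in> _\<close> \<open>B \<in> _\<close> by auto
    then show ?thesis using X_le[of i j] X_le[of j i] by (cases "i \<le> j") auto
  qed
  show ?thesis
  proof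
    show "megamatroid d rk"
      unfolding megamatroid_def
    proof (intro conjI allI impI)
      show "rk A \<in> eInts \<union> {\<infinity>}" for A by (auto simp: rk_def)
      show "rk {} = 0" using rk_X[of 0] X_0 by simp
      show "rk {1..d} \<in> eInts" using rk_X[of k] X_k by simp
      fix A B assume AB: "rk A \<in> eInts \<and> rk B \<in> eInts"
      then have "A \<subseteq> B \<or> B \<subseteq> A" using X_chain by (simp add: rk_eInts)
      then have "A \<union> B = A \<and> A \<inter> B = B \<or> A \<union> B = B \<and> A \<inter> B = A" by blast
      then show "rk (A \<union> B) \<in> eInts" "rk (A \<inter> B) \<in> eInts" "rk (A \<union> B) + rk (A \<inter> B) \<le> rk A + rk B"
        using AB by (auto simp: add.commute)
    qed
    show "rk {1..d} = ereal (of_int r)" using rk_X[of k] X_k rs by simp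
    have "(\<forall>A\<subseteq>{1..d}. ereal (\<Sum>i\<in>A. y i) \<le> rk A) \<longleftrightarrow>
        (\<forall>j\<in>{1..k}. (\<Sum>i\<in>X j. y i) \<le> of_int (rval rs j))" for y :: "nat \<Rightarrow> real"
    proof
      assume *: "\<forall>A\<subseteq>{1..d}. ereal (\<Sum>i\<in>A. y i) \<le> rk A"
      show "\<forall>j\<in>{1..k}. (\<Sum>i\<in>X j. y i) \<le> of_int (rval rs j)"
      proof
        fix j assume "j \<in> {1..k}"
        then show "(\<Sum>i\<in>X j. y i) \<le> of_int (rval rs j)"
          using *[rule_format, of "X j"] rk_X[of j] X_le[of j k] X_k by simp
      qed
    next
      assume *: "\<forall>j\<in>{1..k}. (\<Sum>i\<in>X j. y i) \<le> of_int (rval rs j)"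
      show "\<forall>A\<subseteq>{1..d}. ereal (\<Sum>i\<in>A. y i) \<le> rk A"
      proof (intro allI impI)
        fix A show "ereal (\<Sum>i\<in>A. y i) \<le> rk A"
        proof (cases "A \<in> X ` {..k}")
          case True
          then obtain j where "j \<le> k" "A = X j" by auto
          then show ?thesis using * rk_X[of j] X_0 by (cases "j = 0") auto
        qed (simp add: rk_def)
      qed
    qed
    moreover have "rk {1..d} = ereal (of_int r)" by fact
    ultimately show "R_poly MM d Z = base_polyhedron d rk"
      using rs by (simp add: Z_eq R_MM_def base_polyhedron_def k_def X_def)
  qed
qed

text \<open>For polymatroids and matroids the function \<open>rk\<close> of the box chain serves, as
  the box polytope is all of \<open>R_poly\<close>: \<open>l = 0\<close> makes \<open>rk\<close>
  monotone and \<open>u = 1\<close> bounds it by 1 on singletons.\<close>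

lemma R_poly_is_base_polyhedron:
  assumes Z: "Z \<in> p_set \<kappa> d r"
  obtains rk where "of_kind \<kappa> d rk" "rk {1..d} = ereal (of_int r)" "R_poly \<kappa> d Z = base_polyhedron d rk"
proof (cases \<kappa>)
  case MM
  then show ?thesis using R_MM_is_base_polyhedron[of Z d r] Z that by auto
next
  case PM
  then have Z': "Z \<in> p_PM d r" using Z by simp
  interpret strict_box_chain d 0 "\<bar>r\<bar> + 1" "length (fst Z)" "Xset (fst Z)" "rval (snd Z)"
    by (rule p_PM_strict_box_chain[OF Z'])
  show ?thesis
    using that[of "\<lambda>A. ereal (of_int (rk A))"] polymatroid_rk base_polyhedron_rk
      PM_chain_polytope[OF Z'] PM rk_ground p_PM_rval(4)[OF Z'] by simp
next
  case Mat
  then have Z': "Z \<in> p_M d r" "Z \<in> p_PM d r" using Z by (auto simp: p_M_def)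
  interpret strict_box_chain d 0 1 "length (fst Z)" "Xset (fst Z)" "rval (snd Z)"
    by (rule p_M_strict_box_chain[OF Z'(1)])
  show ?thesis
    using that[of "\<lambda>A. ereal (of_int (rk A))"] matroid_rk base_polyhedron_rk
      M_chain_polytope[OF Z'(1)] Mat rk_ground p_PM_rval(4)[OF Z'(2)] by simp
qed

subsection \<open>Spanning\<close>

lemma finite_chain_sorted_list:
  assumes "finite C" "\<And>A B. A \<in> C \<Longrightarrow> B \<in> C \<Longrightarrow> A \<subseteq> B \<or> B \<subseteq> A"
  obtains Ys where "sorted_wrt (\<subset>) Ys" "set Ys = C"
proof -
  have "\<exists>Ys. sorted_wrt (\<subset>) Ys \<and> set Ys = C"
    using assms
  proof (induction "card C" arbitrary: C)
    case 0
    then show ?case by (intro exI[of _ "[]"]) auto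
  next
    case (Suc n)
    then have "C \<noteq> {}" by auto
    moreover have "subset.chain UNIV C" using Suc.prems(2) by (auto simp: subset.chain_def)
    ultimately have U: "\<Union>C \<in> C" using Suc.prems(1) by (intro Union_in_chain)
    define D where "D = C - {\<Union>C}"
    have "n = card D" "finite D" using Suc.hyps(2) Suc.prems(1) U by (auto simp: D_def)
    then obtain Ys where Ys: "sorted_wrt (\<subset>) Ys" "set Ys = D"
      using Suc.hyps(1)[of D] Suc.prems(2) by (auto simp: D_def)
    have "sorted_wrt (\<subset>) (Ys @ [\<Union>C])"
      using Ys by (auto simp: sorted_wrt_append D_def)
    moreover have "set (Ys @ [\<Union>C]) = C" using Ys U by (auto simp: D_def)
    ultimately show ?case by blast
  qed
  then show ?thesis using that by blast
qed

lemma finite_chain_is_chain: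
  assumes "C \<subseteq> Pow {1..d} - {{}, {1..d}}" "\<And>A B. A \<in> C \<Longrightarrow> B \<in> C \<Longrightarrow> A \<subseteq> B \<or> B \<subseteq> A"
  obtains Xs where "is_chain d Xs" "Xset Xs ` {..length Xs} = insert {} (insert {1..d} C)"
proof -
  define C' where "C' = insert {} (insert {1..d} C)"
  have "C \<subseteq> Pow {1..d}" using assms(1) by blast
  then have "finite C'" and C': "C' \<subseteq> Pow {1..d}"
    using finite_subset[of C "Pow {1..d}"] by (auto simp: C'_def)
  have C'_chain: "A \<subseteq> B \<or> B \<subseteq> A" if AB: "A \<in> C'" "B \<in> C'" for A B
  proof (cases "A \<in> C \<and> B \<in> C")
    case True
    then show ?thesis using assms(2) by blast
  next
    case False
    then have "A = {} \<or> A = {1..d} \<or> B = {} \<or> B = {1..d}" using AB by (auto simp: C'_def)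
    moreover have "A \<subseteq> {1..d}" "B \<subseteq> {1..d}" using AB C' by blast+
    ultimately show ?thesis by fast
  qed
  obtain Ys where Ys: "sorted_wrt (\<subset>) Ys" "set Ys = C'"
    by (rule finite_chain_sorted_list[OF \<open>finite C'\<close> C'_chain])
  \<comment> \<open>\<open>Ys\<close> starts with the empty set, which \<open>Xset\<close> prepends
    on its own; so the chain is the tail \<open>Xs\<close>.\<close>
  then obtain Y Xs where Y: "Ys = Y # Xs" by (cases Ys) (auto simp: C'_def)
  have "{} \<in> set Ys" using Ys by (simp add: C'_def)
  then have "Y = {}" using Ys(1) Y by auto
  have im: "Xset Xs ` {..length Xs} = set Ys"
    unfolding Y \<open>Y = {}\<close> Xset_def set_conv_nth by (auto simp: less_Suc_eq_le)
  have mono: "Xset Xs i \<subset> Xset Xs j" if "i < j" "j \<le> length Xs" for i j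
    using Ys(1) that unfolding Y \<open>Y = {}\<close> sorted_wrt_iff_nth_less Xset_def by simp
  have "{1..d} \<in> Xset Xs ` {..length Xs}" using im Ys by (simp add: C'_def)
  then obtain j where j: "j \<le> length Xs" "Xset Xs j = {1..d}" by auto
  have "Xset Xs (length Xs) \<subseteq> {1..d}" using im Ys C' by blast
  then have "Xset Xs (length Xs) = {1..d}"
    using mono[of j "length Xs"] j by (cases "j = length Xs") auto
  then have "is_chain d Xs" using mono by (simp add: is_chain_def)
  then show ?thesis using that im Ys(2) by (simp add: C'_def)
qed

text \<open>For polymatroids \<open>0 \<le> y i\<close> follows by comparing the total with
  \<open>rk ({1..d} - {i}) \<le> rk {1..d}\<close>; for matroids also
  \<open>y i \<le> rk {i} \<le> 1\<close>.\<close>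

lemma base_polyhedron_eq_obeying:
  assumes rk: "of_kind \<kappa> d rk" "rk {1..d} = ereal (of_int r)"
  shows "base_polyhedron d rk = {y \<in> ambient \<kappa> d r. \<forall>A\<subseteq>{1..d}. obeys rk y A}"
proof -
  have "y \<in> ambient \<kappa> d r" if y: "y \<in> base_polyhedron d rk" for y
  proof -
    have sum: "(\<Sum>i\<in>{1..d}. y i) = of_int r" and le: "\<And>A. A \<subseteq> {1..d} \<Longrightarrow> ereal (\<Sum>i\<in>A. y i) \<le> rk A"
      and "y \<in> rvec d" using y rk(2) by (auto simp: base_polyhedron_def)
    have nonneg: "0 \<le> y i" if "polymatroid d rk" "i \<in> {1..d}" for i
    proof -
      have "ereal (\<Sum>j\<in>{1..d} - {i}. y j) \<le> rk ({1..d} - {i})" by (rule le) auto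
      moreover have "\<forall>A B. A \<subseteq> B \<and> B \<subseteq> {1..d} \<longrightarrow> rk A \<le> rk B"
        using that(1) by (simp add: polymatroid_def)
      then have "rk ({1..d} - {i}) \<le> rk {1..d}" by (meson Diff_subset order_refl)
      ultimately have "ereal (\<Sum>j\<in>{1..d} - {i}. y j) \<le> rk {1..d}" by (meson order_trans)
      then have "(\<Sum>j\<in>{1..d} - {i}. y j) \<le> of_int r" using rk(2) by simp
      moreover have "(\<Sum>j\<in>{1..d}. y j) = y i + (\<Sum>j\<in>{1..d} - {i}. y j)"
        using that(2) by (intro sum.remove) auto
      ultimately show ?thesis using sum by linarith
    qed
    have le_1: "y i \<le> 1" if "matroid d rk" "i \<in> {1..d}" for i
    proof -
      have "ereal (y i) \<le> rk {i}" using le[of "{i}"] that(2) by simp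
      also have "\<dots> \<le> 1" using that unfolding matroid_def by blast
      finally show ?thesis by (simp add: one_ereal_def)
    qed
    show ?thesis
      using rk(1) \<open>y \<in> rvec d\<close> sum nonneg le_1
      by (cases \<kappa>) (auto simp: simplex_PM_def simplex_M_def matroid_def)
  qed
  then show ?thesis
    using ambientD rk(2) by (auto simp: base_polyhedron_def obeys_def)
qed

text \<open>Let \<open>y\<close> violate the constraint at \<open>j\<close> alone. Nonnegative
  coordinates give \<open>r_j < y(X_j) \<le> y(X_(j+1)) \<le> r_(j+1)\<close>; coordinates at most 1
  give, by comparison with \<open>X_(j-1)\<close>, the strict growth of \<open>|X_j| - r_j\<close>.
  The inequality \<open>0 \<le> r_1\<close> and the last one for matroids come from the point
  \<open>y0\<close> and are weak.\<close>

lemma irredundant_chain_in_p_set: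
  assumes chain: "is_chain d Xs" and len: "length rs = length Xs" "rval rs (length rs) = r"
    and y0: "y0 \<in> R_poly \<kappa> d (Xs, rs)"
    and irred: "\<And>j. 1 \<le> j \<Longrightarrow> j < length Xs \<Longrightarrow> \<exists>y\<in>ambient \<kappa> d r.
      of_int (rval rs j) < (\<Sum>i\<in>Xset Xs j. y i) \<and>
      (\<forall>m\<le>length Xs. m \<noteq> j \<longrightarrow> (\<Sum>i\<in>Xset Xs m. y i) \<le> of_int (rval rs m))"
  shows "(Xs, rs) \<in> p_set \<kappa> d r"
proof -
  let ?X = "Xset Xs" and ?k = "length Xs"
  have MM: "(Xs, rs) \<in> p_MM d r" using chain len by (simp add: p_MM_def)
  have X_k: "?X ?k = {1..d}" using chain by (simp add: is_chain_def)
  have X_sub: "?X j \<subseteq> {1..d}" if "j \<le> ?k" for j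
    using is_chain_mono[OF chain, of j ?k] that X_k by (cases "j = ?k") auto
  have X_fin: "finite (?X j)" if "j \<le> ?k" for j using X_sub[OF that] finite_subset by blast
  have y0: "y0 \<in> ambient \<kappa> d r" "\<And>j. 1 \<le> j \<Longrightarrow> j \<le> ?k \<Longrightarrow> (\<Sum>i\<in>?X j. y0 i) \<le> of_int (rval rs j)"
    using y0 unfolding R_poly_eq[OF len(2)] by auto
  have p_PMI: "(Xs, rs) \<in> p_PM d r"
    if nonneg: "\<And>y i. y \<in> ambient \<kappa> d r \<Longrightarrow> i \<in> {1..d} \<Longrightarrow> 0 \<le> y i"
  proof -
    have "0 \<le> rval rs 1" if k: "1 \<le> ?k"
    proof -
      have "0 \<le> (\<Sum>i\<in>?X 1. y0 i)" using nonneg[OF y0(1)] X_sub[OF k] by (intro sum_nonneg) auto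
      then have "0 \<le> real_of_int (rval rs 1)" using y0(2)[of 1] k by linarith
      then show ?thesis by simp
    qed
    moreover have "rval rs j < rval rs (Suc j)" if j: "1 \<le> j" "j < ?k" for j
    proof -
      obtain y where y: "y \<in> ambient \<kappa> d r" "of_int (rval rs j) < (\<Sum>i\<in>?X j. y i)"
        "(\<Sum>i\<in>?X (Suc j). y i) \<le> of_int (rval rs (Suc j))"
        using irred[OF j] j by fastforce
      have "(\<Sum>i\<in>?X j. y i) \<le> (\<Sum>i\<in>?X (Suc j). y i)"
        using is_chain_mono[OF chain, of j "Suc j"] j X_fin X_sub[of "Suc j"] nonneg[OF y(1)]
        by (intro sum_mono2) auto
      then have "real_of_int (rval rs j) < of_int (rval rs (Suc j))" using y by linarith
      then show ?thesis by simp
    qed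
    ultimately show ?thesis using MM len by (simp add: p_PM_def)
  qed
  have step: "(\<Sum>i\<in>?X j. y i) \<le> (\<Sum>i\<in>?X (j - 1). y i) + of_int (int (card (?X j)) - int (card (?X (j - 1))))"
    if "y \<in> simplex_M d r" "1 \<le> j" "j \<le> ?k" for y j
  proof -
    have sub: "?X (j - 1) \<subseteq> ?X j" using is_chain_mono[OF chain, of "j - 1" j] that by auto
    have "(\<Sum>i\<in>?X j - ?X (j - 1). y i) \<le> of_nat (card (?X j - ?X (j - 1))) * 1"
      using that X_sub[OF that(3)] by (intro sum_bounded_above) (auto simp: simplex_M_def)
    moreover have "real (card (?X j - ?X (j - 1))) = of_int (int (card (?X j)) - int (card (?X (j - 1))))"
      using card_Xset_Diff(1)[OF chain, of "j - 1" j] that by (metis diff_less less_numeral_extra(1) less_le_trans of_int_of_nat_eq)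
    moreover have "(\<Sum>i\<in>?X j. y i) = (\<Sum>i\<in>?X j - ?X (j - 1). y i) + (\<Sum>i\<in>?X (j - 1). y i)"
      using sub X_fin[OF that(3)] by (rule sum.subset_diff)
    ultimately show ?thesis by linarith
  qed
  show ?thesis
  proof (cases \<kappa>)
    case MM
    then show ?thesis using \<open>(Xs, rs) \<in> p_MM d r\<close> by simp
  next
    case PM
    then have "(Xs, rs) \<in> p_PM d r"
      by (intro p_PMI) (auto simp: simplex_PM_def)
    then show ?thesis using PM by simp
  next
    case Mat
    define c where "c j = int (card (?X j)) - rval rs j" for j
    have "c (j - 1) < c j" if j: "1 \<le> j" "j < ?k" for j
    proof -
      obtain y where y: "y \<in> simplex_M d r" "of_int (rval rs j) < (\<Sum>i\<in>?X j. y i)"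
        "(\<Sum>i\<in>?X (j - 1). y i) \<le> of_int (rval rs (j - 1))"
        using irred[OF j] j Mat by fastforce
      then have "real_of_int (c (j - 1)) < of_int (c j)"
        using step[of y j] j unfolding c_def by simp
      then show ?thesis by simp
    qed
    moreover have "c (?k - 1) \<le> c ?k" if k: "1 \<le> ?k"
    proof -
      have y: "y0 \<in> simplex_M d r" using y0(1) Mat by simp
      have "(\<Sum>i\<in>?X (?k - 1). y0 i) \<le> of_int (rval rs (?k - 1))"
        using y0(2)[of "?k - 1"] k by (cases "?k - 1 = 0") auto
      moreover have "(\<Sum>i\<in>?X ?k. y0 i) = of_int (rval rs ?k)"
        using y len X_k by (simp add: simplex_M_def)
      ultimately have "real_of_int (c (?k - 1)) \<le> of_int (c ?k)"
        using step[OF y k] unfolding c_def by simp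
      then show ?thesis by simp
    qed
    moreover have "(Xs, rs) \<in> p_PM d r" using Mat by (intro p_PMI) (auto simp: simplex_M_def)
    ultimately show ?thesis using Mat by (simp add: p_M_def Let_def c_def)
  qed
qed

lemma chain_region_is_R_poly:
  fixes v :: "nat set \<Rightarrow> int"
  assumes C: "C \<subseteq> Pow {1..d} - {{}, {1..d}}" "\<And>A B. A \<in> C \<Longrightarrow> B \<in> C \<Longrightarrow> A \<subseteq> B \<or> B \<subseteq> A"
    and ne: "{y \<in> ambient \<kappa> d r. \<forall>A\<in>C. (\<Sum>i\<in>A. y i) \<le> of_int (v A)} \<noteq> {}"
  shows "\<exists>Z\<in>p_set \<kappa> d r. R_poly \<kappa> d Z = {y \<in> ambient \<kappa> d r. \<forall>A\<in>C. (\<Sum>i\<in>A. y i) \<le> of_int (v A)}"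
proof -
  define R where "R D = {y \<in> ambient \<kappa> d r. \<forall>A\<in>D. (\<Sum>i\<in>A. y i) \<le> real_of_int (v A)}" for D
  have "finite C" using C(1) finite_subset[of C "Pow {1..d}"] by blast
  \<comment> \<open>A smallest subfamily that cuts out the same region, so that none of its
    constraints is redundant.\<close>
  define D where "D = arg_min card (\<lambda>D. D \<subseteq> C \<and> R D = R C)"
  have D: "D \<subseteq> C" "R D = R C"
    using arg_min_natI[of "\<lambda>D. D \<subseteq> C \<and> R D = R C" C card] by (auto simp: D_def)
  have D_min: "card D \<le> card D'" if "D' \<subseteq> C" "R D' = R C" for D'
    unfolding D_def using that by (intro arg_min_nat_le) auto
  have "finite D" using D(1) \<open>finite C\<close> finite_subset by blast
  obtain y0 where y0: "y0 \<in> R D" using ne D by (auto simp: R_def)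
  obtain Xs where Xs: "is_chain d Xs" "Xset Xs ` {..length Xs} = insert {} (insert {1..d} D)"
    using finite_chain_is_chain[of D d] C D(1) by (metis subset_iff subset_trans)
  have X_k: "Xset Xs (length Xs) = {1..d}" using Xs(1) by (simp add: is_chain_def)
  have D_iff: "Xset Xs j \<in> D" if "1 \<le> j" "j < length Xs" for j
  proof -
    have "Xset Xs j \<in> insert {} (insert {1..d} D)" using that unfolding Xs(2)[symmetric] by simp
    moreover have "Xset Xs j \<noteq> {}" "Xset Xs j \<noteq> {1..d}"
      using is_chain_mono[OF Xs(1), of 0 j] is_chain_mono[OF Xs(1), of j "length Xs"] that X_k by auto
    ultimately show ?thesis by blast
  qed
  \<comment> \<open>The ground set must carry the total \<open>r\<close>, whatever \<open>v\<close>
    says there.\<close>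
  define w where "w A = (if A = {1..d} then r else v A)" for A
  define rs where "rs = map w Xs"
  have len: "length rs = length Xs" by (simp add: rs_def)
  have rval: "rval rs j = w (Xset Xs j)" if "1 \<le> j" "j \<le> length Xs" for j
    using that by (cases j) (auto simp: rval_def rs_def Xset_def)
  have last: "rval rs (length rs) = r"
  proof (cases "Xs = []")
    case True
    \<comment> \<open>An empty chain means \<open>d = 0\<close>; the empty sum at a point of the
      region then forces \<open>r = 0\<close>.\<close>
    then have "d = 0" using X_k by (cases d) auto
    then have "r = 0" using ambientD(2)[of y0 \<kappa> d r] y0 by (simp add: R_def)
    then show ?thesis using True by (simp add: rs_def)
  next
    case False
    then show ?thesis using rval[of "length Xs"] X_k len by (simp add: w_def Suc_le_eq)
  qed
  have rval_D: "rval rs j = v (Xset Xs j)" if "1 \<le> j" "j < length Xs" for j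
    using rval[of j] is_chain_mono[OF Xs(1), of j "length Xs"] that X_k by (auto simp: w_def)
  have R_Xs: "R D = R_poly \<kappa> d (Xs, rs)"
  proof -
    have "(\<forall>A\<in>D. (\<Sum>i\<in>A. y i) \<le> of_int (v A)) \<longleftrightarrow>
        (\<forall>j\<in>{1..length Xs}. (\<Sum>i\<in>Xset Xs j. y i) \<le> of_int (rval rs j))"
      if y: "y \<in> ambient \<kappa> d r" for y
    proof
      assume *: "\<forall>A\<in>D. (\<Sum>i\<in>A. y i) \<le> of_int (v A)"
      show "\<forall>j\<in>{1..length Xs}. (\<Sum>i\<in>Xset Xs j. y i) \<le> of_int (rval rs j)"
      proof
        fix j assume j: "j \<in> {1..length Xs}"
        show "(\<Sum>i\<in>Xset Xs j. y i) \<le> of_int (rval rs j)"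
        proof (cases "j = length Xs")
          case True
          then show ?thesis using ambientD(2)[OF y] X_k last len by simp
        next
          case False
          then show ?thesis using * D_iff[of j] rval_D[of j] j by simp
        qed
      qed
    next
      assume *: "\<forall>j\<in>{1..length Xs}. (\<Sum>i\<in>Xset Xs j. y i) \<le> of_int (rval rs j)"
      show "\<forall>A\<in>D. (\<Sum>i\<in>A. y i) \<le> of_int (v A)"
      proof
        fix A assume A: "A \<in> D"
        then have "A \<in> Xset Xs ` {..length Xs}" unfolding Xs(2) by simp
        then obtain j where j: "j \<le> length Xs" "A = Xset Xs j" by auto
        have "A \<noteq> {}" "A \<noteq> {1..d}" using A D(1) C(1) by auto
        then have "1 \<le> j" "j < length Xs" using j X_k by (cases j; cases "j = length Xs"; auto)+
        then show "(\<Sum>i\<in>A. y i) \<le> of_int (v A)" using *[rule_format, of j] rval_D[of j] j by simp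
      qed
    qed
    then show ?thesis unfolding R_poly_eq[OF last] R_def by blast
  qed
  have "(Xs, rs) \<in> p_set \<kappa> d r"
  proof (rule irredundant_chain_in_p_set[OF Xs(1) len last])
    show "y0 \<in> R_poly \<kappa> d (Xs, rs)" using y0 R_Xs by simp
    fix j assume j: "1 \<le> j" "j < length Xs"
    define D' where "D' = D - {Xset Xs j}"
    have "card D' < card D" unfolding D'_def using D_iff[OF j] \<open>finite D\<close> by (intro card_Diff1_less)
    \<comment> \<open>By minimality, dropping the \<open>j\<close>-th constraint enlarges the
      region, and a new point violates that constraint alone.\<close>
    then have "R D' \<noteq> R D" using D_min[of D'] D by (auto simp: D'_def)
    moreover have "R D \<subseteq> R D'" by (auto simp: R_def D'_def)
    ultimately obtain y where y: "y \<in> R D'" "y \<notin> R D" by blast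
    have amb: "y \<in> ambient \<kappa> d r" using y by (simp add: R_def)
    obtain A where A: "A \<in> D" "\<not> (\<Sum>i\<in>A. y i) \<le> of_int (v A)"
      using y(2) amb by (auto simp: R_def)
    have y_D': "(\<Sum>i\<in>A. y i) \<le> of_int (v A)" if "A \<in> D'" for A
      using y(1) that by (simp add: R_def)
    have "A = Xset Xs j" using A y_D'[of A] by (auto simp: D'_def)
    then have "of_int (rval rs j) < (\<Sum>i\<in>Xset Xs j. y i)"
      using A(2) rval_D[OF j] by simp
    moreover have "(\<Sum>i\<in>Xset Xs m. y i) \<le> of_int (rval rs m)" if m: "m \<le> length Xs" "m \<noteq> j" for m
    proof -
      consider "m = 0" | "m = length Xs" | "1 \<le> m" "m < length Xs" using m by linarith
      then show ?thesis
      proof cases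
        case 2
        then show ?thesis using ambientD(2)[OF amb] X_k last len by simp
      next
        case 3
        have "Xset Xs m \<noteq> Xset Xs j"
          using is_chain_mono[OF Xs(1), of m j] is_chain_mono[OF Xs(1), of j m] m j
          by (cases "m < j") auto
        then show ?thesis using y_D'[of "Xset Xs m"] D_iff[OF 3] rval_D[OF 3] by (simp add: D'_def)
      qed simp
    qed
    ultimately show "\<exists>y\<in>ambient \<kappa> d r. of_int (rval rs j) < (\<Sum>i\<in>Xset Xs j. y i) \<and>
        (\<forall>m\<le>length Xs. m \<noteq> j \<longrightarrow> (\<Sum>i\<in>Xset Xs m. y i) \<le> of_int (rval rs m))"
      using amb by blast
  qed
  then show ?thesis
    using trans[OF R_Xs[symmetric] D(2)] unfolding R_def by (rule bexI[rotated])
qed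

lemma chain_regions_in_span_R_poly:
  assumes rk: "megamatroid d rk" "rk {1..d} = ereal (of_int r)"
    and g: "g \<in> chain_regions rk (ambient \<kappa> d r) {1..d}"
  shows "g \<in> zmod.span ((\<lambda>Z. indicator (R_poly \<kappa> d Z)) ` p_set \<kappa> d r)"
proof -
  obtain \<C> where \<C>: "\<C> \<subseteq> Pow {1..d}" "\<forall>A\<in>\<C>. \<forall>A'\<in>\<C>. A \<subseteq> A' \<or> A' \<subseteq> A"
    and g: "g = indicator {y\<in>ambient \<kappa> d r. \<forall>A\<in>\<C>. obeys rk y A}"
    using g by (auto simp: chain_regions_def)
  \<comment> \<open>The discarded sets impose nothing on points of the ambient set. On the others
    \<open>rk\<close> is integral, and the floor in \<open>v\<close> merely changes the
    type.\<close>
  define D where "D = {A\<in>\<C>. A \<noteq> {} \<and> A \<noteq> {1..d} \<and> rk A \<noteq> \<infinity>}"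
  define v where "v A = \<lfloor>real_of_ereal (rk A)\<rfloor>" for A
  have rk_empty: "rk {} = 0" using rk(1) by (simp add: megamatroid_def)
  have rk_range: "rk A \<in> eInts \<union> {\<infinity>}" if "A \<subseteq> {1..d}" for A
    using rk(1) that unfolding megamatroid_def by blast
  have rk_v: "rk A = ereal (of_int (v A))" if "A \<in> D" for A
  proof -
    have "rk A \<in> eInts" using that rk_range[of A] \<C>(1) by (auto simp: D_def)
    then show ?thesis by (auto simp: v_def elim: eInts_cases)
  qed
  have "(\<forall>A\<in>\<C>. obeys rk y A) \<longleftrightarrow> (\<forall>A\<in>D. (\<Sum>i\<in>A. y i) \<le> of_int (v A))"
    if y: "y \<in> ambient \<kappa> d r" for y
  proof
    assume *: "\<forall>A\<in>\<C>. obeys rk y A"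
    show "\<forall>A\<in>D. (\<Sum>i\<in>A. y i) \<le> of_int (v A)"
    proof
      fix A assume A: "A \<in> D"
      then have "obeys rk y A" using * by (simp add: D_def)
      then show "(\<Sum>i\<in>A. y i) \<le> of_int (v A)" using rk_v[OF A] by (simp add: obeys_def)
    qed
  next
    assume *: "\<forall>A\<in>D. (\<Sum>i\<in>A. y i) \<le> of_int (v A)"
    show "\<forall>A\<in>\<C>. obeys rk y A"
    proof
      fix A assume "A \<in> \<C>"
      then consider "A \<in> D" | "A = {}" | "A = {1..d}" | "rk A = \<infinity>" by (auto simp: D_def)
      then show "obeys rk y A"
      proof cases
        case 1 then show ?thesis using * rk_v[of A] by (simp add: obeys_def)
      next
        case 2 then show ?thesis using rk_empty by (simp add: obeys_def)
      next
        case 3 then show ?thesis using ambientD(2)[OF y] rk(2) by (simp add: obeys_def)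
      qed (simp add: obeys_def)
    qed
  qed
  then have g: "g = indicator {y \<in> ambient \<kappa> d r. \<forall>A\<in>D. (\<Sum>i\<in>A. y i) \<le> of_int (v A)}"
    unfolding g by (intro arg_cong[of _ _ indicator]) blast
  show ?thesis
  proof (cases "{y \<in> ambient \<kappa> d r. \<forall>A\<in>D. (\<Sum>i\<in>A. y i) \<le> real_of_int (v A)} = {}")
    case True
    \<comment> \<open>An empty region need not belong to any index, but it contributes the zero
      function.\<close>
    then have "g = 0" unfolding g True by (simp add: fun_eq_iff)
    then show ?thesis by (simp add: zmod.span_zero)
  next
    case False
    have D_sub: "D \<subseteq> Pow {1..d} - {{}, {1..d}}" using \<C>(1) by (auto simp: D_def)
    have D_chain: "A \<subseteq> B \<or> B \<subseteq> A" if "A \<in> D" "B \<in> D" for A B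
      using that \<C>(2) unfolding D_def by blast
    obtain Z where "Z \<in> p_set \<kappa> d r"
      "R_poly \<kappa> d Z = {y \<in> ambient \<kappa> d r. \<forall>A\<in>D. (\<Sum>i\<in>A. y i) \<le> of_int (v A)}"
      using chain_region_is_R_poly[OF D_sub D_chain False] by (rule bexE)
    then have "Z \<in> p_set \<kappa> d r" "g = indicator (R_poly \<kappa> d Z)" by (simp_all only: g)
    then show ?thesis by (intro zmod.span_base) blast
  qed
qed

lemma of_kind_megamatroid: "of_kind \<kappa> d rk \<Longrightarrow> megamatroid d rk"
  by (cases \<kappa>) (auto simp: matroid_def polymatroid_def)

theorem theorem5p4:
  fixes \<kappa> :: kind and d :: nat and r :: int
  shows "free_abelian_basis (P_group \<kappa> d r) (p_set \<kappa> d r)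
           (\<lambda>Z. indicator (R_poly \<kappa> d Z))"
proof (rule free_abelian_basisI)
  show "a Z = 0"
    if "finite F" "F \<subseteq> p_set \<kappa> d r" "\<And>y. (\<Sum>Z\<in>F. a Z * indicator (R_poly \<kappa> d Z) y) = (0::int)" "Z \<in> F"
    for F a Z
    by (rule R_poly_indicators_independent[OF that])
  let ?gens = "{indicator (base_polyhedron d rk) | rk. of_kind \<kappa> d rk \<and> rk {1..d} = ereal (of_int r)}
    :: ((nat \<Rightarrow> real) \<Rightarrow> int) set"
  let ?basis = "(\<lambda>Z. indicator (R_poly \<kappa> d Z)) ` p_set \<kappa> d r :: ((nat \<Rightarrow> real) \<Rightarrow> int) set"
  have "?basis \<subseteq> ?gens"
  proof
    fix g assume "g \<in> ?basis"
    then obtain Z where Z: "Z \<in> p_set \<kappa> d r" "g = indicator (R_poly \<kappa> d Z)" by blast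
    obtain rk where "of_kind \<kappa> d rk" "rk {1..d} = ereal (of_int r)" "R_poly \<kappa> d Z = base_polyhedron d rk"
      by (rule R_poly_is_base_polyhedron[OF Z(1)])
    then show "g \<in> ?gens" using Z(2) by auto
  qed
  moreover have "?gens \<subseteq> zmod.span ?basis"
  proof
    fix g assume "g \<in> ?gens"
    then obtain rk where rk: "of_kind \<kappa> d rk" "rk {1..d} = ereal (of_int r)"
      and g: "g = indicator (base_polyhedron d rk)" by blast
    note mega = of_kind_megamatroid[OF rk(1)]
    have "g \<in> zmod.span (chain_regions rk (ambient \<kappa> d r) {1..d})"
      unfolding g base_polyhedron_eq_obeying[OF rk]
      by (rule indicator_obeying_in_span_chain_regions[OF mega order_refl])
    moreover have "chain_regions rk (ambient \<kappa> d r) {1..d} \<subseteq> zmod.span ?basis"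
      using chain_regions_in_span_R_poly[OF mega rk(2)] by blast
    ultimately show "g \<in> zmod.span ?basis"
      using zmod.span_minimal[OF _ zmod.subspace_span] by blast
  qed
  ultimately show "zmod.span ?basis = P_group \<kappa> d r"
    unfolding P_group_def
    by (intro antisym zmod.span_mono zmod.span_minimal zmod.subspace_span)
qed

end
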